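(* Let $M$ be a $G$-graded $R$-module that is graded secondful and graded faithful. Then: (1) $\mathrm{Spec}_G^s(M)$ with the Zariski topology is a Noetherian topological space if and only if every graded second submodule of $M$ is an $RFG_g^{*}$-submodule. (2) If $N_1$ and $N_2$ are $RFG_g^{*}$-submodules of $M$, then so is $N_1+N_2$.
   Context: $G$ is an abelian group with identity $e$; all rings are commutative with unity $1$. A $G$-graded ring is a ring $R=\bigoplus_{g\in G}R_g$ with additive subgroups $R_g$ satisfying $R_gR_h\subseteq R_{gh}$; $h(R)=\bigcup_{g}R_g$. An ideal $I$ is graded ($I\lhd_G R$) if $I=\bigoplus_g (I\cap R_g)$; it is graded finitely generated if $I=Rr_1+\dots+Rr_n$ for some $r_1,\dots,r_n\in I\cap h(R)$. A graded prime ideal is a proper graded ideal $p$ such that for $a,b\in h(R)$, $ab\in p$ implies $a\in p$ or $b\in p$; $\mathrm{Spec}_G(R)$ is the set of all graded prime ideals. A $G$-graded $R$-module is an $R$-module $M=\bigoplus_{g\in G}M_g$ with $R_gM_h\subseteq M_{gh}$; a submodule $N$ is graded ($N\leq_G M$) if $N=\bigoplus_g(N\cap M_g)$. $Ann_R(N)=\{r\in R: rN=0\}$ and $Ann_M(I)=\{m\in M: Im=0\}$. A non-zero graded submodule $S$ of $M$ is graded second if for every $r\in h(R)$, $rS=S$ or $rS=0$ (then $Ann_R(S)$ is a graded prime ideal); $\mathrm{Spec}_G^s(M)$ is the set of all graded second submodules of $M$. The Zariski topology on $\mathrm{Spec}_G^s(M)$ has as closed sets $V_G^s(N)=\{S\in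 \mathrm{Spec}_G^s(M): Ann_R(N)\subseteq Ann_R(S)\}$, $N\leq_G M$. The graded Zariski socle $Z.soc_G(N)$ is the sum of all members of $V_G^s(N)$ ($\{0\}$ if $V_G^s(N)=\emptyset$). A graded submodule $N$ of $M$ is an $RFG_g^{*}$-submodule if $Z.soc_G(N)=Z.soc_G(Ann_M(I))$ for some graded finitely generated ideal $I$ of $R$. $M$ is graded secondful if the natural map $\phi:\mathrm{Spec}_G^s(M)\to \mathrm{Spec}_G(R/Ann_R(M))$, $S\mapsto Ann_R(S)/Ann_R(M)$, is surjective. $M$ is graded faithful if $r\in h(R)$ and $rM=0$ imply $r=0$. A topological space is Noetherian if its closed sets satisfy the descending chain condition. *)

theory Defs
  imports "HOL-Algebra.Module" "HOL-Algebra.QuotRing" "HOL-Analysis.Abstract_Topology"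
begin

section \<open>Internal direct sums\<close>

definition fs_families :: "('a, 'm) ring_scheme \<Rightarrow> 'i set \<Rightarrow> ('i \<Rightarrow> 'a set) \<Rightarrow> ('i \<Rightarrow> 'a) set" where
  "fs_families M I A = {f \<in> \<Pi>\<^sub>E i\<in>I. A i. finite {i \<in> I. f i \<noteq> \<zero>\<^bsub>M\<^esub>}}"

text \<open>
  The sum is taken over the support because \<^const>\<open>finsum\<close> over an infinite index set is
  a default value.
\<close>

definition fs_sum :: "('a, 'm) ring_scheme \<Rightarrow> 'i set \<Rightarrow> ('i \<Rightarrow> 'a) \<Rightarrow> 'a" where
  "fs_sum M I f = (\<Oplus>\<^bsub>M\<^esub>i\<in>{i \<in> I. f i \<noteq> \<zero>\<^bsub>M\<^esub>}. f i)"

definition is_direct_sum :: "('a, 'm) ring_scheme \<Rightarrow> 'i set \<Rightarrow> ('i \<Rightarrow> 'a set) \<Rightarrow> 'a set \<Rightarrow> bool" where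
  "is_direct_sum M I A H \<longleftrightarrow>
     (\<forall>i\<in>I. additive_subgroup (A i) M) \<and> bij_betw (fs_sum M I) (fs_families M I A) H"


section \<open>Graded rings and graded ideals\<close>

locale graded_ring = G?: comm_group G + R?: cring R
  for G :: "('g, 'k) monoid_scheme" (structure) and R :: "('a, 'm) ring_scheme" (structure)
    and \<R> :: "'g \<Rightarrow> 'a set" +
  assumes ring_decomp: "is_direct_sum R (carrier G) \<R> (carrier R)"
    and ring_graded_mult:
      "\<And>g h a b. \<lbrakk>g \<in> carrier G; h \<in> carrier G; a \<in> \<R> g; b \<in> \<R> h\<rbrakk>
         \<Longrightarrow> a \<otimes>\<^bsub>R\<^esub> b \<in> \<R> (g \<otimes>\<^bsub>G\<^esub> h)"

definition homogeneous :: "('g, 'k) monoid_scheme \<Rightarrow> ('g \<Rightarrow> 'a set) \<Rightarrow> 'a set" where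
  "homogeneous G \<R> = (\<Union>g\<in>carrier G. \<R> g)"

definition graded_ideal ::
  "('g, 'k) monoid_scheme \<Rightarrow> ('a, 'm) ring_scheme \<Rightarrow> ('g \<Rightarrow> 'a set) \<Rightarrow> 'a set \<Rightarrow> bool" where
  "graded_ideal G R \<R> I \<longleftrightarrow> ideal I R \<and> is_direct_sum R (carrier G) (\<lambda>g. I \<inter> \<R> g) I"

definition graded_fg_ideal ::
  "('g, 'k) monoid_scheme \<Rightarrow> ('a, 'm) ring_scheme \<Rightarrow> ('g \<Rightarrow> 'a set) \<Rightarrow> 'a set \<Rightarrow> bool" where
  "graded_fg_ideal G R \<R> I \<longleftrightarrow>
     graded_ideal G R \<R> I \<and> (\<exists>A \<subseteq> I \<inter> homogeneous G \<R>. finite A \<and> I = Idl\<^bsub>R\<^esub> A)"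

definition graded_prime_ideal ::
  "('g, 'k) monoid_scheme \<Rightarrow> ('a, 'm) ring_scheme \<Rightarrow> ('g \<Rightarrow> 'a set) \<Rightarrow> 'a set \<Rightarrow> bool" where
  "graded_prime_ideal G R \<R> p \<longleftrightarrow>
     graded_ideal G R \<R> p \<and> p \<noteq> carrier R \<and>
     (\<forall>a \<in> homogeneous G \<R>. \<forall>b \<in> homogeneous G \<R>. a \<otimes>\<^bsub>R\<^esub> b \<in> p \<longrightarrow> a \<in> p \<or> b \<in> p)"

definition graded_Spec ::
  "('g, 'k) monoid_scheme \<Rightarrow> ('a, 'm) ring_scheme \<Rightarrow> ('g \<Rightarrow> 'a set) \<Rightarrow> 'a set set" where
  "graded_Spec G R \<R> = {p. graded_prime_ideal G R \<R> p}"

text \<open>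
  For \<open>J \<supseteq> I\<close>, the set \<open>cosets_of R I J\<close> of cosets of \<open>I\<close> represented in \<open>J\<close> is \<open>J / I\<close>.
  The quotient by a graded ideal \<open>I\<close> carries the grading with components \<open>(\<R> g + I) / I\<close>.
\<close>

definition cosets_of :: "('a, 'm) ring_scheme \<Rightarrow> 'a set \<Rightarrow> 'a set \<Rightarrow> 'a set set" where
  "cosets_of R I J = (\<lambda>r. I +>\<^bsub>R\<^esub> r) ` J"

definition quotient_grading ::
  "('a, 'm) ring_scheme \<Rightarrow> ('g \<Rightarrow> 'a set) \<Rightarrow> 'a set \<Rightarrow> 'g \<Rightarrow> 'a set set" where
  "quotient_grading R \<R> I g = cosets_of R I (\<R> g)"


section \<open>Graded modules\<close>

locale graded_module = graded_ring G R \<R> + M?: Module.module R M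
  for G :: "('g, 'k) monoid_scheme" (structure) and R :: "('a, 'm) ring_scheme" (structure)
    and \<R> :: "'g \<Rightarrow> 'a set" and M :: "('a, 'b, 'n) module_scheme" (structure)
    and \<M> :: "'g \<Rightarrow> 'b set" +
  assumes module_decomp: "is_direct_sum M (carrier G) \<M> (carrier M)"
    and module_graded_smult:
      "\<And>g h a x. \<lbrakk>g \<in> carrier G; h \<in> carrier G; a \<in> \<R> g; x \<in> \<M> h\<rbrakk>
         \<Longrightarrow> a \<odot>\<^bsub>M\<^esub> x \<in> \<M> (g \<otimes>\<^bsub>G\<^esub> h)"

definition graded_submodule ::
  "('g, 'k) monoid_scheme \<Rightarrow> ('a, 'm) ring_scheme \<Rightarrow> ('a, 'b, 'n) module_scheme \<Rightarrow> ('g \<Rightarrow> 'b set)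
     \<Rightarrow> 'b set \<Rightarrow> bool" where
  "graded_submodule G R M \<M> N \<longleftrightarrow>
     submodule N R M \<and> is_direct_sum M (carrier G) (\<lambda>g. N \<inter> \<M> g) N"

definition ann_ring :: "('a, 'm) ring_scheme \<Rightarrow> ('a, 'b, 'n) module_scheme \<Rightarrow> 'b set \<Rightarrow> 'a set" where
  "ann_ring R M N = {r \<in> carrier R. \<forall>x\<in>N. r \<odot>\<^bsub>M\<^esub> x = \<zero>\<^bsub>M\<^esub>}"

definition ann_mod :: "('a, 'b, 'n) module_scheme \<Rightarrow> 'a set \<Rightarrow> 'b set" where
  "ann_mod M I = {x \<in> carrier M. \<forall>r\<in>I. r \<odot>\<^bsub>M\<^esub> x = \<zero>\<^bsub>M\<^esub>}"

definition graded_second ::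
  "('g, 'k) monoid_scheme \<Rightarrow> ('a, 'm) ring_scheme \<Rightarrow> ('g \<Rightarrow> 'a set) \<Rightarrow> ('a, 'b, 'n) module_scheme
     \<Rightarrow> ('g \<Rightarrow> 'b set) \<Rightarrow> 'b set \<Rightarrow> bool" where
  "graded_second G R \<R> M \<M> S \<longleftrightarrow>
     graded_submodule G R M \<M> S \<and> S \<noteq> {\<zero>\<^bsub>M\<^esub>} \<and>
     (\<forall>r \<in> homogeneous G \<R>. (\<lambda>x. r \<odot>\<^bsub>M\<^esub> x) ` S = S \<or> (\<lambda>x. r \<odot>\<^bsub>M\<^esub> x) ` S = {\<zero>\<^bsub>M\<^esub>})"

definition second_Spec ::
  "('g, 'k) monoid_scheme \<Rightarrow> ('a, 'm) ring_scheme \<Rightarrow> ('g \<Rightarrow> 'a set) \<Rightarrow> ('a, 'b, 'n) module_scheme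
     \<Rightarrow> ('g \<Rightarrow> 'b set) \<Rightarrow> 'b set set" where
  "second_Spec G R \<R> M \<M> = {S. graded_second G R \<R> M \<M> S}"

definition second_V ::
  "('g, 'k) monoid_scheme \<Rightarrow> ('a, 'm) ring_scheme \<Rightarrow> ('g \<Rightarrow> 'a set) \<Rightarrow> ('a, 'b, 'n) module_scheme
     \<Rightarrow> ('g \<Rightarrow> 'b set) \<Rightarrow> 'b set \<Rightarrow> 'b set set" where
  "second_V G R \<R> M \<M> N = {S \<in> second_Spec G R \<R> M \<M>. ann_ring R M N \<subseteq> ann_ring R M S}"

definition second_Zariski ::
  "('g, 'k) monoid_scheme \<Rightarrow> ('a, 'm) ring_scheme \<Rightarrow> ('g \<Rightarrow> 'a set) \<Rightarrow> ('a, 'b, 'n) module_scheme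
     \<Rightarrow> ('g \<Rightarrow> 'b set) \<Rightarrow> 'b set topology" where
  "second_Zariski G R \<R> M \<M> = topology (\<lambda>U. \<exists>N. graded_submodule G R M \<M> N \<and>
     U = second_Spec G R \<R> M \<M> - second_V G R \<R> M \<M> N)"

definition noetherian_space :: "'a topology \<Rightarrow> bool" where
  "noetherian_space T \<longleftrightarrow>
     (\<forall>C :: nat \<Rightarrow> 'a set. (\<forall>n. closedin T (C n)) \<and> decseq C \<longrightarrow> (\<exists>m. \<forall>n\<ge>m. C n = C m))"

definition submodules_sum :: "('a, 'b, 'n) module_scheme \<Rightarrow> 'b set set \<Rightarrow> 'b set" where
  "submodules_sum M \<S> = {\<Oplus>\<^bsub>M\<^esub>S\<in>F. x S | F x. finite F \<and> F \<subseteq> \<S> \<and> x \<in> (\<Pi> S\<in>F. S)}"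

definition Zariski_socle ::
  "('g, 'k) monoid_scheme \<Rightarrow> ('a, 'm) ring_scheme \<Rightarrow> ('g \<Rightarrow> 'a set) \<Rightarrow> ('a, 'b, 'n) module_scheme
     \<Rightarrow> ('g \<Rightarrow> 'b set) \<Rightarrow> 'b set \<Rightarrow> 'b set" where
  "Zariski_socle G R \<R> M \<M> N = submodules_sum M (second_V G R \<R> M \<M> N)"

definition RFG_submodule ::
  "('g, 'k) monoid_scheme \<Rightarrow> ('a, 'm) ring_scheme \<Rightarrow> ('g \<Rightarrow> 'a set) \<Rightarrow> ('a, 'b, 'n) module_scheme
     \<Rightarrow> ('g \<Rightarrow> 'b set) \<Rightarrow> 'b set \<Rightarrow> bool" where
  "RFG_submodule G R \<R> M \<M> N \<longleftrightarrow>
     graded_submodule G R M \<M> N \<and>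
     (\<exists>I. graded_fg_ideal G R \<R> I \<and>
        Zariski_socle G R \<R> M \<M> N = Zariski_socle G R \<R> M \<M> (ann_mod M I))"

definition graded_secondful ::
  "('g, 'k) monoid_scheme \<Rightarrow> ('a, 'm) ring_scheme \<Rightarrow> ('g \<Rightarrow> 'a set) \<Rightarrow> ('a, 'b, 'n) module_scheme
     \<Rightarrow> ('g \<Rightarrow> 'b set) \<Rightarrow> bool" where
  "graded_secondful G R \<R> M \<M> \<longleftrightarrow>
     (let A = ann_ring R M (carrier M)
      in (\<lambda>S. cosets_of R A (ann_ring R M S)) ` second_Spec G R \<R> M \<M>
           = graded_Spec G (R Quot A) (quotient_grading R \<R> A))"

definition graded_faithful ::
  "('g, 'k) monoid_scheme \<Rightarrow> ('a, 'm) ring_scheme \<Rightarrow> ('g \<Rightarrow> 'a set) \<Rightarrow> ('a, 'b, 'n) module_scheme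
     \<Rightarrow> bool" where
  "graded_faithful G R \<R> M \<longleftrightarrow>
     (\<forall>r \<in> homogeneous G \<R>. (\<forall>x \<in> carrier M. r \<odot>\<^bsub>M\<^esub> x = \<zero>\<^bsub>M\<^esub>) \<longrightarrow> r = \<zero>\<^bsub>R\<^esub>)"


section \<open>The sets \<open>second_V G R \<R> M \<M> N\<close> are the closed sets of a topology\<close>

context abelian_group begin

lemma fs_sum_superset:
  assumes "finite T" "{i \<in> I. f i \<noteq> \<zero>} \<subseteq> T" "T \<subseteq> I" "\<And>i. i \<in> I \<Longrightarrow> f i \<in> carrier G"
  shows "fs_sum G I f = (\<Oplus>i\<in>T. f i)"
  unfolding fs_sum_def
  by (rule add.finprod_mono_neutral_cong_left) (use assms in auto)

lemma is_direct_sum_restrictI: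
  assumes D: "is_direct_sum G I A (carrier G)" and H: "additive_subgroup H G"
    and comp: "\<And>f i. \<lbrakk>f \<in> fs_families G I A; fs_sum G I f \<in> H; i \<in> I\<rbrakk> \<Longrightarrow> f i \<in> H"
  shows "is_direct_sum G I (\<lambda>i. H \<inter> A i) H"
proof -
  have A: "\<And>i. i \<in> I \<Longrightarrow> additive_subgroup (A i) G"
    and bij: "bij_betw (fs_sum G I) (fs_families G I A) (carrier G)"
    using D by (auto simp: is_direct_sum_def)
  have sub: "fs_families G I (\<lambda>i. H \<inter> A i) \<subseteq> fs_families G I A"
    by (auto simp: fs_families_def)
  have HG: "H \<subseteq> carrier G" using H additive_subgroup.a_subset by blast
  have "fs_sum G I ` fs_families G I (\<lambda>i. H \<inter> A i) = H"
  proof (intro equalityI subsetI)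
    fix x assume "x \<in> fs_sum G I ` fs_families G I (\<lambda>i. H \<inter> A i)"
    then obtain f where f: "f \<in> fs_families G I (\<lambda>i. H \<inter> A i)" and x: "x = fs_sum G I f" by auto
    have "(\<Oplus>i\<in>T. f i) \<in> H" if "finite T" "T \<subseteq> I" for T
      using that
    proof (induction T)
      case empty
      show ?case using additive_subgroup.zero_closed[OF H] by simp
    next
      case (insert i T)
      have fI: "\<And>j. j \<in> I \<Longrightarrow> f j \<in> H" using f by (auto simp: fs_families_def)
      show ?case
        using insert fI HG additive_subgroup.a_closed[OF H] subsetD[OF HG fI]
        by (subst finsum_insert) auto
    qed
    then show "x \<in> H"
      using f unfolding x fs_sum_def by (auto simp: fs_families_def)
  next
    fix x assume x: "x \<in> H"
    then obtain f where f: "f \<in> fs_families G I A" "fs_sum G I f = x"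
      using bij HG unfolding bij_betw_def by (metis imageE subset_iff)
    then have "f \<in> fs_families G I (\<lambda>i. H \<inter> A i)"
      using comp[OF f(1)] x by (auto simp: fs_families_def PiE_iff)
    then show "x \<in> fs_sum G I ` fs_families G I (\<lambda>i. H \<inter> A i)" using f by blast
  qed
  moreover have "additive_subgroup (H \<inter> A i) G" if "i \<in> I" for i
    using H A[OF that] a_group group.subgroups_Inter_pair
    unfolding additive_subgroup_def by blast
  ultimately show ?thesis
    using bij sub unfolding is_direct_sum_def bij_betw_def
    by (auto intro: inj_on_subset)
qed

lemma is_direct_sum_component:
  assumes D: "is_direct_sum G I A (carrier G)" and DH: "is_direct_sum G I (\<lambda>i. H \<inter> A i) H"
    and f: "f \<in> fs_families G I A" "fs_sum G I f \<in> H" "i \<in> I"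
  shows "f i \<in> H"
proof -
  obtain f' where f': "f' \<in> fs_families G I (\<lambda>i. H \<inter> A i)" "fs_sum G I f' = fs_sum G I f"
    using DH f(2) unfolding is_direct_sum_def bij_betw_def by (metis imageE)
  then have "f' \<in> fs_families G I A" by (auto simp: fs_families_def)
  then have "f' = f"
    using D f(1) f'(2) unfolding is_direct_sum_def bij_betw_def by (metis inj_onD)
  then show ?thesis using f' f(3) by (auto simp: fs_families_def)
qed

lemma is_direct_sum_obtain:
  assumes DH: "is_direct_sum G I A H" and "x \<in> H"
  obtains f where "f \<in> fs_families G I A" "fs_sum G I f = x"
  using assms unfolding is_direct_sum_def bij_betw_def by (metis imageE)

lemma is_direct_sum_zero:
  assumes D: "is_direct_sum G I A (carrier G)"
    and f: "f \<in> fs_families G I A" "fs_sum G I f = \<zero>" "i \<in> I"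
  shows "f i = \<zero>"
proof -
  let ?z = "\<lambda>i\<in>I. \<zero>"
  have "?z \<in> fs_families G I A"
    using D by (auto simp: fs_families_def is_direct_sum_def additive_subgroup.zero_closed)
  moreover have "fs_sum G I ?z = \<zero>"
    unfolding fs_sum_def by (metis (mono_tags, lifting) finsum_empty empty_Collect_eq restrict_apply')
  ultimately have "f = ?z"
    using D f unfolding is_direct_sum_def bij_betw_def by (metis inj_onD)
  then show ?thesis using f(3) by simp
qed

end

context graded_module begin

lemma finsum_smult_rdistr:
  assumes "finite T" "x \<in> carrier M" "c \<in> T \<rightarrow> carrier R"
  shows "(\<Oplus>\<^bsub>R\<^esub>i\<in>T. c i) \<odot>\<^bsub>M\<^esub> x = (\<Oplus>\<^bsub>M\<^esub>i\<in>T. c i \<odot>\<^bsub>M\<^esub> x)"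
  using assms by (induction T) (auto simp: smult_l_distr Pi_def)

lemma ring_component: "f \<in> fs_families R (carrier G) \<R> \<Longrightarrow> g \<in> carrier G \<Longrightarrow> f g \<in> \<R> g"
  and module_component: "f' \<in> fs_families M (carrier G) \<M> \<Longrightarrow> g \<in> carrier G \<Longrightarrow> f' g \<in> \<M> g"
  by (auto simp: fs_families_def)

lemma ring_homogeneous_carrier: "g \<in> carrier G \<Longrightarrow> a \<in> \<R> g \<Longrightarrow> a \<in> carrier R"
  using ring_decomp additive_subgroup.a_subset unfolding is_direct_sum_def by blast

lemma module_homogeneous_carrier: "g \<in> carrier G \<Longrightarrow> x \<in> \<M> g \<Longrightarrow> x \<in> carrier M"
  using module_decomp additive_subgroup.a_subset unfolding is_direct_sum_def by blast

lemma module_homogeneous_zero: "g \<in> carrier G \<Longrightarrow> \<zero>\<^bsub>M\<^esub> \<in> \<M> g"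
  using module_decomp additive_subgroup.zero_closed unfolding is_direct_sum_def by blast

lemma smult_fs_sum_eq_zero:
  assumes g: "g \<in> carrier G" "a \<in> \<R> g" and f: "f \<in> fs_families M (carrier G) \<M>"
    and z: "a \<odot>\<^bsub>M\<^esub> fs_sum M (carrier G) f = \<zero>\<^bsub>M\<^esub>" and h: "h \<in> carrier G"
  shows "a \<odot>\<^bsub>M\<^esub> f h = \<zero>\<^bsub>M\<^esub>"
proof -
  define f' where "f' = (\<lambda>k\<in>carrier G. a \<odot>\<^bsub>M\<^esub> f (inv g \<otimes>\<^bsub>G\<^esub> k))"
  let ?T = "{i \<in> carrier G. f i \<noteq> \<zero>\<^bsub>M\<^esub>}"
  let ?T' = "(\<lambda>k. g \<otimes>\<^bsub>G\<^esub> k) ` ?T"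
  have a: "a \<in> carrier R" using g ring_homogeneous_carrier by blast
  have fc: "f k \<in> carrier M" if "k \<in> carrier G" for k
    using that f module_component module_homogeneous_carrier by blast
  have fin: "finite ?T" using f by (simp add: fs_families_def)
  have supp: "{k \<in> carrier G. f' k \<noteq> \<zero>\<^bsub>M\<^esub>} \<subseteq> ?T'"
  proof
    fix k assume k: "k \<in> {k \<in> carrier G. f' k \<noteq> \<zero>\<^bsub>M\<^esub>}"
    then have "inv g \<otimes>\<^bsub>G\<^esub> k \<in> ?T" using g a by (auto simp: f'_def)
    moreover have "k = g \<otimes>\<^bsub>G\<^esub> (inv g \<otimes>\<^bsub>G\<^esub> k)"
      using g k by (simp flip: G.m_assoc)
    ultimately show "k \<in> ?T'" by blast
  qed
  have comp: "f' k \<in> \<M> k" if k: "k \<in> carrier G" for k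
  proof -
    have "a \<odot>\<^bsub>M\<^esub> f (inv g \<otimes>\<^bsub>G\<^esub> k) \<in> \<M> (g \<otimes>\<^bsub>G\<^esub> (inv g \<otimes>\<^bsub>G\<^esub> k))"
      using g k f module_component by (intro module_graded_smult) auto
    then show ?thesis using g k by (simp add: f'_def flip: G.m_assoc)
  qed
  have f': "f' \<in> fs_families M (carrier G) \<M>"
    using comp finite_subset[OF supp] fin by (auto simp: fs_families_def f'_def)
  have fc': "f' k \<in> carrier M" if "k \<in> carrier G" for k
    using comp that module_homogeneous_carrier by blast
  have "fs_sum M (carrier G) f' = (\<Oplus>\<^bsub>M\<^esub>k\<in>?T'. f' k)"
    using supp fin g fc' by (intro M.fs_sum_superset) auto
  also have "\<dots> = (\<Oplus>\<^bsub>M\<^esub>k\<in>?T. f' (g \<otimes>\<^bsub>G\<^esub> k))"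
    using g fc' by (intro M.finsum_reindex) (auto simp: inj_on_def)
  also have "\<dots> = (\<Oplus>\<^bsub>M\<^esub>k\<in>?T. a \<odot>\<^bsub>M\<^esub> f k)"
    using g a fc by (intro M.finsum_cong') (auto simp: f'_def simp flip: G.m_assoc)
  also have "\<dots> = a \<odot>\<^bsub>M\<^esub> fs_sum M (carrier G) f"
    unfolding fs_sum_def using fin a fc by (intro finsum_smult_ldistr[symmetric]) auto
  finally have "f' (g \<otimes>\<^bsub>G\<^esub> h) = \<zero>\<^bsub>M\<^esub>"
    using M.is_direct_sum_zero[OF module_decomp f'] z g h by simp
  then show ?thesis using g h by (simp add: f'_def flip: G.m_assoc)
qed

lemma fs_sum_smult_eq_zero:
  assumes h: "h \<in> carrier G" "x \<in> \<M> h" and c: "c \<in> fs_families R (carrier G) \<R>"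
    and z: "fs_sum R (carrier G) c \<odot>\<^bsub>M\<^esub> x = \<zero>\<^bsub>M\<^esub>" and g: "g \<in> carrier G"
  shows "c g \<odot>\<^bsub>M\<^esub> x = \<zero>\<^bsub>M\<^esub>"
proof -
  define f' where "f' = (\<lambda>k\<in>carrier G. c (k \<otimes>\<^bsub>G\<^esub> inv h) \<odot>\<^bsub>M\<^esub> x)"
  let ?T = "{i \<in> carrier G. c i \<noteq> \<zero>\<^bsub>R\<^esub>}"
  let ?T' = "(\<lambda>k. k \<otimes>\<^bsub>G\<^esub> h) ` ?T"
  have x: "x \<in> carrier M" using h module_homogeneous_carrier by blast
  have cc: "c k \<in> carrier R" if "k \<in> carrier G" for k
    using that c ring_component ring_homogeneous_carrier by blast
  have fin: "finite ?T" using c by (simp add: fs_families_def)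
  have supp: "{k \<in> carrier G. f' k \<noteq> \<zero>\<^bsub>M\<^esub>} \<subseteq> ?T'"
  proof
    fix k assume k: "k \<in> {k \<in> carrier G. f' k \<noteq> \<zero>\<^bsub>M\<^esub>}"
    then have "k \<otimes>\<^bsub>G\<^esub> inv h \<in> ?T" using h x by (auto simp: f'_def)
    moreover have "k = (k \<otimes>\<^bsub>G\<^esub> inv h) \<otimes>\<^bsub>G\<^esub> h"
      using h k by (simp add: G.m_assoc)
    ultimately show "k \<in> ?T'" by blast
  qed
  have comp: "f' k \<in> \<M> k" if k: "k \<in> carrier G" for k
  proof -
    have "c (k \<otimes>\<^bsub>G\<^esub> inv h) \<odot>\<^bsub>M\<^esub> x \<in> \<M> ((k \<otimes>\<^bsub>G\<^esub> inv h) \<otimes>\<^bsub>G\<^esub> h)"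
      using h k c ring_component by (intro module_graded_smult) auto
    then show ?thesis using h k by (simp add: f'_def G.m_assoc)
  qed
  have f': "f' \<in> fs_families M (carrier G) \<M>"
    using comp finite_subset[OF supp] fin by (auto simp: fs_families_def f'_def)
  have fc': "f' k \<in> carrier M" if "k \<in> carrier G" for k
    using comp that module_homogeneous_carrier by blast
  have "fs_sum M (carrier G) f' = (\<Oplus>\<^bsub>M\<^esub>k\<in>?T'. f' k)"
    using supp fin h fc' by (intro M.fs_sum_superset) auto
  also have "\<dots> = (\<Oplus>\<^bsub>M\<^esub>k\<in>?T. f' (k \<otimes>\<^bsub>G\<^esub> h))"
    using h fc' by (intro M.finsum_reindex) (auto simp: inj_on_def)
  also have "\<dots> = (\<Oplus>\<^bsub>M\<^esub>k\<in>?T. c k \<odot>\<^bsub>M\<^esub> x)"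
    using h x cc by (intro M.finsum_cong') (auto simp: f'_def G.m_assoc)
  also have "\<dots> = fs_sum R (carrier G) c \<odot>\<^bsub>M\<^esub> x"
    unfolding fs_sum_def using fin x cc by (intro finsum_smult_rdistr[symmetric]) auto
  finally have "f' (g \<otimes>\<^bsub>G\<^esub> h) = \<zero>\<^bsub>M\<^esub>"
    using M.is_direct_sum_zero[OF module_decomp f'] z g h by simp
  then show ?thesis using g h by (simp add: f'_def G.m_assoc)
qed

lemma fs_sum_smult_zeroI:
  assumes c: "c \<in> fs_families R (carrier G) \<R>" and x: "x \<in> carrier M"
    and z: "\<And>g. g \<in> carrier G \<Longrightarrow> c g \<odot>\<^bsub>M\<^esub> x = \<zero>\<^bsub>M\<^esub>"
  shows "fs_sum R (carrier G) c \<odot>\<^bsub>M\<^esub> x = \<zero>\<^bsub>M\<^esub>"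
proof -
  have cc: "c k \<in> carrier R" if "k \<in> carrier G" for k
    using that c ring_component ring_homogeneous_carrier by blast
  have "fs_sum R (carrier G) c \<odot>\<^bsub>M\<^esub> x
          = (\<Oplus>\<^bsub>M\<^esub>i\<in>{i \<in> carrier G. c i \<noteq> \<zero>\<^bsub>R\<^esub>}. c i \<odot>\<^bsub>M\<^esub> x)"
    unfolding fs_sum_def using c cc x
    by (intro finsum_smult_rdistr) (auto simp: fs_families_def)
  also have "\<dots> = \<zero>\<^bsub>M\<^esub>"
    using z by (intro M.add.finprod_one_eqI) auto
  finally show ?thesis .
qed

lemma smult_fs_sum_zeroI:
  assumes f: "f \<in> fs_families M (carrier G) \<M>" and a: "a \<in> carrier R"
    and z: "\<And>g. g \<in> carrier G \<Longrightarrow> a \<odot>\<^bsub>M\<^esub> f g = \<zero>\<^bsub>M\<^esub>"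
  shows "a \<odot>\<^bsub>M\<^esub> fs_sum M (carrier G) f = \<zero>\<^bsub>M\<^esub>"
proof -
  have fc: "f k \<in> carrier M" if "k \<in> carrier G" for k
    using that f module_component module_homogeneous_carrier by blast
  have "a \<odot>\<^bsub>M\<^esub> fs_sum M (carrier G) f
          = (\<Oplus>\<^bsub>M\<^esub>i\<in>{i \<in> carrier G. f i \<noteq> \<zero>\<^bsub>M\<^esub>}. a \<odot>\<^bsub>M\<^esub> f i)"
    unfolding fs_sum_def using f fc a
    by (intro finsum_smult_ldistr) (auto simp: fs_families_def)
  also have "\<dots> = \<zero>\<^bsub>M\<^esub>"
    using z by (intro M.add.finprod_one_eqI) auto
  finally show ?thesis .
qed

lemma ann_ring_component:
  assumes N: "graded_submodule G R M \<M> N" and c: "c \<in> fs_families R (carrier G) \<R>"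
    and s: "fs_sum R (carrier G) c \<in> ann_ring R M N" and g: "g \<in> carrier G"
  shows "c g \<in> ann_ring R M N"
proof -
  have cg: "c g \<in> carrier R" using c g ring_component ring_homogeneous_carrier by blast
  have DN: "is_direct_sum M (carrier G) (\<lambda>g. N \<inter> \<M> g) N"
    using N by (simp add: graded_submodule_def)
  have "c g \<odot>\<^bsub>M\<^esub> x = \<zero>\<^bsub>M\<^esub>" if "x \<in> N" for x
  proof -
    obtain f where f: "f \<in> fs_families M (carrier G) (\<lambda>g. N \<inter> \<M> g)"
      and x: "fs_sum M (carrier G) f = x"
      using M.is_direct_sum_obtain[OF DN \<open>x \<in> N\<close>] by blast
    have fM: "f \<in> fs_families M (carrier G) \<M>" using f by (auto simp: fs_families_def)
    have "c g \<odot>\<^bsub>M\<^esub> f h = \<zero>\<^bsub>M\<^esub>" if h: "h \<in> carrier G" for h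
    proof (rule fs_sum_smult_eq_zero[OF h _ c _ g])
      show "f h \<in> \<M> h" using fM h module_component by blast
      have "f h \<in> N" using f h by (auto simp: fs_families_def)
      then show "fs_sum R (carrier G) c \<odot>\<^bsub>M\<^esub> f h = \<zero>\<^bsub>M\<^esub>" using s by (simp add: ann_ring_def)
    qed
    then show ?thesis using smult_fs_sum_zeroI[OF fM cg] x by simp
  qed
  then show ?thesis using cg by (simp add: ann_ring_def)
qed

lemma ann_mod_graded:
  assumes J: "J \<subseteq> carrier R"
    and comp: "\<And>c g. \<lbrakk>c \<in> fs_families R (carrier G) \<R>; fs_sum R (carrier G) c \<in> J; g \<in> carrier G\<rbrakk>
                 \<Longrightarrow> c g \<in> J"
  shows "graded_submodule G R M \<M> (ann_mod M J)"
proof -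
  have sub: "submodule (ann_mod M J) R M"
  proof (rule submoduleI)
    fix a x assume a: "a \<in> carrier R" and x: "x \<in> ann_mod M J"
    have "r \<odot>\<^bsub>M\<^esub> (a \<odot>\<^bsub>M\<^esub> x) = \<zero>\<^bsub>M\<^esub>" if r: "r \<in> J" for r
    proof -
      have "r \<odot>\<^bsub>M\<^esub> (a \<odot>\<^bsub>M\<^esub> x) = (a \<otimes>\<^bsub>R\<^esub> r) \<odot>\<^bsub>M\<^esub> x"
        using r a x J R.m_comm by (metis (no_types, lifting) ann_mod_def mem_Collect_eq smult_assoc1 subsetD)
      also have "\<dots> = \<zero>\<^bsub>M\<^esub>"
        using r a x J by (auto simp: ann_mod_def smult_assoc1 subsetD)
      finally show ?thesis .
    qed
    then show "a \<odot>\<^bsub>M\<^esub> x \<in> ann_mod M J" using a x by (simp add: ann_mod_def)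
  next
    fix x assume x: "x \<in> ann_mod M J"
    have "r \<odot>\<^bsub>M\<^esub> (\<ominus>\<^bsub>M\<^esub> x) = \<zero>\<^bsub>M\<^esub>" if "r \<in> J" for r
      using that x J smult_r_minus[of r x] by (auto simp: ann_mod_def)
    then show "\<ominus>\<^bsub>M\<^esub> x \<in> ann_mod M J" using x by (simp add: ann_mod_def)
  qed (use J in \<open>auto simp: ann_mod_def smult_r_distr subsetD\<close>)
  moreover have "is_direct_sum M (carrier G) (\<lambda>g. ann_mod M J \<inter> \<M> g) (ann_mod M J)"
  proof (rule M.is_direct_sum_restrictI[OF module_decomp])
    show "additive_subgroup (ann_mod M J) M"
      using sub by (simp add: submodule_def additive_subgroup_def)
    fix f h assume f: "f \<in> fs_families M (carrier G) \<M>"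
      and s: "fs_sum M (carrier G) f \<in> ann_mod M J" and h: "h \<in> carrier G"
    have fh: "f h \<in> carrier M" using f h module_component module_homogeneous_carrier by blast
    have "r \<odot>\<^bsub>M\<^esub> f h = \<zero>\<^bsub>M\<^esub>" if r: "r \<in> J" for r
    proof -
      obtain c where c: "c \<in> fs_families R (carrier G) \<R>" and cr: "fs_sum R (carrier G) c = r"
        using R.is_direct_sum_obtain[OF ring_decomp] r J by blast
      have "c g \<odot>\<^bsub>M\<^esub> f h = \<zero>\<^bsub>M\<^esub>" if g: "g \<in> carrier G" for g
        using smult_fs_sum_eq_zero[OF g ring_component[OF c g] f _ h] comp[OF c _ g] s r cr
        by (simp add: ann_mod_def)
      then show ?thesis using fs_sum_smult_zeroI[OF c fh] cr by simp
    qed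
    then show "f h \<in> ann_mod M J" using fh by (simp add: ann_mod_def)
  qed
  ultimately show ?thesis by (simp add: graded_submodule_def)
qed

lemma graded_secondD:
  assumes "S \<in> second_Spec G R \<R> M \<M>"
  shows "S \<subseteq> carrier M" "\<zero>\<^bsub>M\<^esub> \<in> S" "S \<noteq> {\<zero>\<^bsub>M\<^esub>}"
    "r \<in> homogeneous G \<R> \<Longrightarrow>
       (\<lambda>x. r \<odot>\<^bsub>M\<^esub> x) ` S = S \<or> (\<lambda>x. r \<odot>\<^bsub>M\<^esub> x) ` S = {\<zero>\<^bsub>M\<^esub>}"
  using assms subgroup.subset[of S "add_monoid M"] subgroup.one_closed[of S "add_monoid M"]
  by (auto simp: second_Spec_def graded_second_def graded_submodule_def submodule_def)

lemma second_V_ann_mod: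
  assumes "J \<subseteq> carrier R"
  shows "second_V G R \<R> M \<M> (ann_mod M J) = {S \<in> second_Spec G R \<R> M \<M>. J \<subseteq> ann_ring R M S}"
proof -
  have "ann_ring R M (ann_mod M J) \<subseteq> ann_ring R M S \<longleftrightarrow> J \<subseteq> ann_ring R M S"
    if "S \<subseteq> carrier M" for S
  proof
    have "J \<subseteq> ann_ring R M (ann_mod M J)" using assms by (auto simp: ann_ring_def ann_mod_def)
    then show "ann_ring R M (ann_mod M J) \<subseteq> ann_ring R M S \<Longrightarrow> J \<subseteq> ann_ring R M S" by blast
  next
    assume "J \<subseteq> ann_ring R M S"
    then have "S \<subseteq> ann_mod M J" using that by (auto simp: ann_ring_def ann_mod_def)
    then show "ann_ring R M (ann_mod M J) \<subseteq> ann_ring R M S" by (auto simp: ann_ring_def)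
  qed
  then show ?thesis using graded_secondD(1) by (auto simp: second_V_def)
qed

lemma graded_second_ann_component:
  assumes S: "S \<in> second_Spec G R \<R> M \<M>" and N: "graded_submodule G R M \<M> N"
    and n: "\<not> ann_ring R M N \<subseteq> ann_ring R M S"
  obtains a where "a \<in> ann_ring R M N" "(\<lambda>x. a \<odot>\<^bsub>M\<^esub> x) ` S = S"
proof -
  obtain r where r: "r \<in> ann_ring R M N" "r \<notin> ann_ring R M S" using n by blast
  then have rc: "r \<in> carrier R" by (simp add: ann_ring_def)
  obtain c where c: "c \<in> fs_families R (carrier G) \<R>" and cr: "fs_sum R (carrier G) c = r"
    using R.is_direct_sum_obtain[OF ring_decomp rc] by blast
  obtain x where x: "x \<in> S" "r \<odot>\<^bsub>M\<^esub> x \<noteq> \<zero>\<^bsub>M\<^esub>" using r rc by (auto simp: ann_ring_def)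
  then have "x \<in> carrier M" using graded_secondD(1)[OF S] by blast
  then obtain g where g: "g \<in> carrier G" "c g \<odot>\<^bsub>M\<^esub> x \<noteq> \<zero>\<^bsub>M\<^esub>"
    using fs_sum_smult_zeroI[OF c] x cr by blast
  have "c g \<in> homogeneous G \<R>" using g ring_component[OF c] by (auto simp: homogeneous_def)
  then have "(\<lambda>x. c g \<odot>\<^bsub>M\<^esub> x) ` S = S" using graded_secondD(4)[OF S] g x by blast
  then show thesis using that ann_ring_component[OF N c _ g(1)] r cr by simp
qed

lemma second_V_Un:
  assumes N1: "graded_submodule G R M \<M> N1" and N2: "graded_submodule G R M \<M> N2"
  shows "second_V G R \<R> M \<M> N1 \<union> second_V G R \<R> M \<M> N2
           = {S \<in> second_Spec G R \<R> M \<M>. ann_ring R M N1 \<inter> ann_ring R M N2 \<subseteq> ann_ring R M S}"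
proof -
  have "ann_ring R M N1 \<subseteq> ann_ring R M S \<or> ann_ring R M N2 \<subseteq> ann_ring R M S"
    if S: "S \<in> second_Spec G R \<R> M \<M>"
      and sub: "ann_ring R M N1 \<inter> ann_ring R M N2 \<subseteq> ann_ring R M S" for S
  proof (rule ccontr)
    assume "\<not> ?thesis"
    then obtain a b where a: "a \<in> ann_ring R M N1" "(\<lambda>x. a \<odot>\<^bsub>M\<^esub> x) ` S = S"
      and b: "b \<in> ann_ring R M N2" "(\<lambda>x. b \<odot>\<^bsub>M\<^esub> x) ` S = S"
      using graded_second_ann_component[OF S N1] graded_second_ann_component[OF S N2] by metis
    have ab: "a \<in> carrier R" "b \<in> carrier R" using a b by (auto simp: ann_ring_def)
    have NM: "N1 \<subseteq> carrier M" "N2 \<subseteq> carrier M"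
      using N1 N2 submoduleE(1) by (auto simp: graded_submodule_def)
    have "a \<otimes>\<^bsub>R\<^esub> b \<in> ann_ring R M N2"
      using ab b NM by (auto simp: ann_ring_def smult_assoc1 subsetD)
    moreover have "b \<otimes>\<^bsub>R\<^esub> a \<in> ann_ring R M N1"
      using ab a NM by (auto simp: ann_ring_def smult_assoc1 subsetD)
    ultimately have "a \<otimes>\<^bsub>R\<^esub> b \<in> ann_ring R M S" using sub R.m_comm[OF ab] by auto
    then have "a \<odot>\<^bsub>M\<^esub> (b \<odot>\<^bsub>M\<^esub> x) = \<zero>\<^bsub>M\<^esub>" if "x \<in> S" for x
      using that ab graded_secondD(1)[OF S] by (auto simp: ann_ring_def smult_assoc1 subsetD)
    then have "(\<lambda>x. a \<odot>\<^bsub>M\<^esub> x) ` (\<lambda>x. b \<odot>\<^bsub>M\<^esub> x) ` S \<subseteq> {\<zero>\<^bsub>M\<^esub>}" by auto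
    then have "S \<subseteq> {\<zero>\<^bsub>M\<^esub>}" by (simp add: a(2) b(2))
    then show False using graded_secondD(2,3)[OF S] by blast
  qed
  then show ?thesis by (auto simp: second_V_def)
qed

lemma istopology_second_Zariski:
  "istopology (\<lambda>U. \<exists>N. graded_submodule G R M \<M> N \<and>
     U = second_Spec G R \<R> M \<M> - second_V G R \<R> M \<M> N)"
  unfolding istopology_def
proof (intro conjI allI impI)
  fix U1 U2
  assume "\<exists>N. graded_submodule G R M \<M> N \<and> U1 = second_Spec G R \<R> M \<M> - second_V G R \<R> M \<M> N"
    and "\<exists>N. graded_submodule G R M \<M> N \<and> U2 = second_Spec G R \<R> M \<M> - second_V G R \<R> M \<M> N"
  then obtain N1 N2 where N: "graded_submodule G R M \<M> N1" "graded_submodule G R M \<M> N2"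
    and U: "U1 = second_Spec G R \<R> M \<M> - second_V G R \<R> M \<M> N1"
      "U2 = second_Spec G R \<R> M \<M> - second_V G R \<R> M \<M> N2" by blast
  let ?J = "ann_ring R M N1 \<inter> ann_ring R M N2"
  have J: "?J \<subseteq> carrier R" by (auto simp: ann_ring_def)
  have "graded_submodule G R M \<M> (ann_mod M ?J)"
    using N ann_ring_component by (intro ann_mod_graded J) blast
  moreover have "U1 \<inter> U2 = second_Spec G R \<R> M \<M> - second_V G R \<R> M \<M> (ann_mod M ?J)"
    using second_V_Un[OF N] second_V_ann_mod[OF J] U by blast
  ultimately show "\<exists>N. graded_submodule G R M \<M> N \<and>
      U1 \<inter> U2 = second_Spec G R \<R> M \<M> - second_V G R \<R> M \<M> N" by blast
next
  fix \<U> assume "\<forall>U\<in>\<U>. \<exists>N. graded_submodule G R M \<M> N \<and>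
      U = second_Spec G R \<R> M \<M> - second_V G R \<R> M \<M> N"
  then obtain n where n: "\<And>U. U \<in> \<U> \<Longrightarrow> graded_submodule G R M \<M> (n U)"
      "\<And>U. U \<in> \<U> \<Longrightarrow> U = second_Spec G R \<R> M \<M> - second_V G R \<R> M \<M> (n U)" by metis
  let ?J = "\<Union>U\<in>\<U>. ann_ring R M (n U)"
  have J: "?J \<subseteq> carrier R" by (auto simp: ann_ring_def)
  have "graded_submodule G R M \<M> (ann_mod M ?J)"
    using n(1) ann_ring_component by (intro ann_mod_graded J) blast
  moreover have "\<Union>\<U> = (\<Union>U\<in>\<U>. second_Spec G R \<R> M \<M> - second_V G R \<R> M \<M> (n U))"
    using n(2) by auto
  then have "\<Union>\<U> = second_Spec G R \<R> M \<M> - second_V G R \<R> M \<M> (ann_mod M ?J)"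
    unfolding second_V_ann_mod[OF J] by (auto simp: second_V_def)
  ultimately show "\<exists>N. graded_submodule G R M \<M> N \<and>
      \<Union>\<U> = second_Spec G R \<R> M \<M> - second_V G R \<R> M \<M> N" by blast
qed

lemma openin_second_Zariski:
  "openin (second_Zariski G R \<R> M \<M>) U \<longleftrightarrow>
     (\<exists>N. graded_submodule G R M \<M> N \<and> U = second_Spec G R \<R> M \<M> - second_V G R \<R> M \<M> N)"
  unfolding second_Zariski_def using topology_inverse'[OF istopology_second_Zariski] by simp

lemma topspace_second_Zariski: "topspace (second_Zariski G R \<R> M \<M>) = second_Spec G R \<R> M \<M>"
proof -
  have "graded_submodule G R M \<M> (ann_mod M (carrier R))"
    using ring_component ring_homogeneous_carrier by (intro ann_mod_graded) blast+
  moreover have "second_V G R \<R> M \<M> (ann_mod M (carrier R)) = {}"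
  proof -
    have "\<not> carrier R \<subseteq> ann_ring R M S" if S: "S \<in> second_Spec G R \<R> M \<M>" for S
    proof
      assume "carrier R \<subseteq> ann_ring R M S"
      then have "\<one>\<^bsub>R\<^esub> \<odot>\<^bsub>M\<^esub> x = \<zero>\<^bsub>M\<^esub>" if "x \<in> S" for x using that by (auto simp: ann_ring_def)
      then have "S \<subseteq> {\<zero>\<^bsub>M\<^esub>}" using graded_secondD(1)[OF S] smult_one by (metis singletonI subsetD subsetI)
      then show False using graded_secondD(2,3)[OF S] by blast
    qed
    then show ?thesis by (auto simp: second_V_ann_mod)
  qed
  ultimately have "openin (second_Zariski G R \<R> M \<M>) (second_Spec G R \<R> M \<M>)"
    unfolding openin_second_Zariski by (metis Diff_empty)
  then show ?thesis
    unfolding topspace_def openin_second_Zariski by blast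
qed

lemma closedin_second_Zariski:
  "closedin (second_Zariski G R \<R> M \<M>) C \<longleftrightarrow>
     (\<exists>N. graded_submodule G R M \<M> N \<and> C = second_V G R \<R> M \<M> N)"
proof -
  have "second_V G R \<R> M \<M> N \<subseteq> second_Spec G R \<R> M \<M>" for N by (auto simp: second_V_def)
  then show ?thesis
    unfolding closedin_def topspace_second_Zariski openin_second_Zariski
    by (metis Diff_Diff_Int inf.absorb_iff2)
qed

end

end

theory Submission
  imports Defs "HOL-Algebra.UnivPoly"
begin

text \<open>
  Two graded submodules have the same Zariski socle iff they have the same variety, so an
  \<open>RFG\<close>-submodule is one whose variety is cut out by finitely many homogeneous ring elements.
  The variety of a sum is the union of the varieties and is cut out by the products of the two
  finite families, because annihilators of graded second submodules are prime on homogeneous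
  elements. The space is Noetherian iff every homogeneous set \<open>E\<close> has a finite subset
  cutting out the same variety. As in Cohen's theorem, it suffices that every graded
  prime ideal has this property: a maximal homogeneous set without it generates a graded prime ideal.
  Since \<open>M\<close> is faithful and secondful, graded primes are exactly the annihilators of graded
  second submodules.
\<close>

section \<open>Direct sums\<close>

context abelian_group begin

lemma additive_subgroup_finsum_closed:
  assumes H: "additive_subgroup H G" and f: "f \<in> T \<rightarrow> H"
  shows "(\<Oplus>i\<in>T. f i) \<in> H"
  using f
proof (induction T rule: infinite_finite_induct)
  case (insert i T)
  then have "f \<in> T \<rightarrow> carrier G" "f i \<in> carrier G"
    using additive_subgroup.a_subset[OF H] by blast+
  then show ?case using insert additive_subgroup.a_closed[OF H] by auto
\<comment> \<open>This covers infinite \<open>T\<close> as well as the empty set: in both cases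
  \<open>finsum\<close> is zero, which lies in \<open>H\<close>.\<close>
qed (use additive_subgroup.zero_closed[OF H] in auto)

text \<open>Cancellation can make the support of the pointwise sum smaller than the two given
  supports. All three sums are therefore taken over the union of the supports before
  \<open>finsum_addf\<close> is applied.\<close>

lemma fs_sum_add:
  assumes A: "\<And>i. i \<in> I \<Longrightarrow> additive_subgroup (A i) G"
    and f: "f \<in> fs_families G I A" and g: "g \<in> fs_families G I A"
  shows "(\<lambda>i\<in>I. f i \<oplus> g i) \<in> fs_families G I A"
    and "fs_sum G I (\<lambda>i\<in>I. f i \<oplus> g i) = fs_sum G I f \<oplus> fs_sum G I g"
proof -
  let ?h = "\<lambda>i\<in>I. f i \<oplus> g i"
  let ?T = "{i \<in> I. f i \<noteq> \<zero>} \<union> {i \<in> I. g i \<noteq> \<zero>}"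
  have T: "finite ?T" "?T \<subseteq> I" using f g by (auto simp: fs_families_def)
  have mem: "f i \<in> A i" "g i \<in> A i" if "i \<in> I" for i
    using that f g by (auto simp: fs_families_def)
  then have c: "f i \<in> carrier G" "g i \<in> carrier G" if "i \<in> I" for i
    using that A additive_subgroup.a_subset by blast+
  have supp: "{i \<in> I. ?h i \<noteq> \<zero>} \<subseteq> ?T" by auto
  show "?h \<in> fs_families G I A"
    using mem additive_subgroup.a_closed[OF A] finite_subset[OF supp T(1)]
    by (auto simp: fs_families_def)
  have "fs_sum G I ?h = (\<Oplus>i\<in>?T. ?h i)"
    using T supp c by (intro fs_sum_superset) auto
  also have "\<dots> = (\<Oplus>i\<in>?T. f i \<oplus> g i)"
    using T c by (intro finsum_cong') auto
  also have "\<dots> = (\<Oplus>i\<in>?T. f i) \<oplus> (\<Oplus>i\<in>?T. g i)"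
    using T c by (intro finsum_addf) auto
  also have "(\<Oplus>i\<in>?T. f i) = fs_sum G I f"
    using T c by (intro fs_sum_superset[symmetric]) auto
  also have "(\<Oplus>i\<in>?T. g i) = fs_sum G I g"
    using T c by (intro fs_sum_superset[symmetric]) auto
  finally show "fs_sum G I ?h = fs_sum G I f \<oplus> fs_sum G I g" .
qed

lemma fs_sum_single:
  assumes A: "\<And>i. i \<in> I \<Longrightarrow> additive_subgroup (A i) G" and j: "j \<in> I" "a \<in> A j"
  shows "(\<lambda>i\<in>I. if i = j then a else \<zero>) \<in> fs_families G I A"
    and "fs_sum G I (\<lambda>i\<in>I. if i = j then a else \<zero>) = a"
proof -
  let ?f = "\<lambda>i\<in>I. if i = j then a else \<zero>"
  have supp: "{i \<in> I. ?f i \<noteq> \<zero>} \<subseteq> {j}" by auto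
  have a: "a \<in> carrier G" using A j additive_subgroup.a_subset by blast
  show "?f \<in> fs_families G I A"
    using j additive_subgroup.zero_closed[OF A] finite_subset[OF supp]
    by (auto simp: fs_families_def)
  have "fs_sum G I ?f = (\<Oplus>i\<in>{j}. ?f i)"
    using supp a j by (intro fs_sum_superset) auto
  then show "fs_sum G I ?f = a" using a j by simp
qed

text \<open>Uniqueness of components is inherited from the ambient group: a decomposition inside
  \<open>H\<close> must be the ambient one. Hence only existence of decompositions remains to be
  checked for generated ideals and for sums of submodules.\<close>

lemma is_direct_sum_restrict_spanI:
  assumes D: "is_direct_sum G I A (carrier G)" and H: "additive_subgroup H G"
    and span: "H \<subseteq> fs_sum G I ` fs_families G I (\<lambda>i. H \<inter> A i)"
  shows "is_direct_sum G I (\<lambda>i. H \<inter> A i) H"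
proof (rule is_direct_sum_restrictI[OF D H])
  fix f i assume f: "f \<in> fs_families G I A" and s: "fs_sum G I f \<in> H" and i: "i \<in> I"
  obtain f' where f': "f' \<in> fs_families G I (\<lambda>i. H \<inter> A i)" "fs_sum G I f' = fs_sum G I f"
    using span s by fastforce
  then have "f' \<in> fs_families G I A" by (auto simp: fs_families_def)
  then have "f' = f" using D f f'(2) by (auto simp: is_direct_sum_def bij_betw_def dest: inj_onD)
  then show "f i \<in> H" using f' i by (auto simp: fs_families_def)
qed

end

text \<open>Injectivity makes a component vanish exactly when its image does, so corresponding
  families have equal supports and \<open>hom_finsum\<close> transports their sums. This moves
  gradings to a quotient by the zero ideal.\<close>

lemma (in ring_hom_ring) is_direct_sum_image:
  assumes inj: "inj_on h (carrier R)" and D: "is_direct_sum R I A B" and B: "B \<subseteq> carrier R"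
  shows "is_direct_sum S I (\<lambda>i. h ` A i) (h ` B)"
proof -
  have A: "\<And>i. i \<in> I \<Longrightarrow> additive_subgroup (A i) R"
    and bij: "bij_betw (fs_sum R I) (fs_families R I A) B"
    using D by (auto simp: is_direct_sum_def)
  have Ac: "a \<in> carrier R" if "i \<in> I" "a \<in> A i" for i a
    using that A additive_subgroup.a_subset by blast
  have h0: "h a = \<zero>\<^bsub>S\<^esub> \<longleftrightarrow> a = \<zero>" if "a \<in> carrier R" for a
    using that inj by (metis hom_zero inj_onD R.zero_closed)
  define F where "F f = (\<lambda>i\<in>I. h (f i))" for f
  have fc: "f i \<in> carrier R" if "f \<in> fs_families R I A" "i \<in> I" for f i
    using that Ac by (auto simp: fs_families_def)
  have supp: "{i \<in> I. F f i \<noteq> \<zero>\<^bsub>S\<^esub>} = {i \<in> I. f i \<noteq> \<zero>}" if "f \<in> fs_families R I A" for f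
    using that fc h0 by (auto simp: F_def)
  have sumF: "fs_sum S I (F f) = h (fs_sum R I f)" if f: "f \<in> fs_families R I A" for f
  proof -
    have "h (fs_sum R I f) = (\<Oplus>\<^bsub>S\<^esub>i\<in>{i \<in> I. f i \<noteq> \<zero>}. (h \<circ> f) i)"
      unfolding fs_sum_def using fc[OF f] by (subst hom_finsum) auto
    also have "\<dots> = fs_sum S I (F f)"
      unfolding fs_sum_def supp[OF f] using fc[OF f] by (intro S.finsum_cong') (auto simp: F_def)
    finally show ?thesis by simp
  qed
  have FI: "F ` fs_families R I A = fs_families S I (\<lambda>i. h ` A i)"
  proof (intro equalityI subsetI)
    fix f' assume "f' \<in> F ` fs_families R I A"
    then show "f' \<in> fs_families S I (\<lambda>i. h ` A i)"
      using supp by (auto simp: fs_families_def) (auto simp: F_def)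
  next
    fix f' assume f': "f' \<in> fs_families S I (\<lambda>i. h ` A i)"
    \<comment> \<open>Preimages are chosen componentwise; by injectivity \<open>f\<close> has the
      same support as \<open>f'\<close>, so finiteness carries over.\<close>
    define f where "f = (\<lambda>i\<in>I. inv_into (A i) h (f' i))"
    have f: "f i \<in> A i" "h (f i) = f' i" if "i \<in> I" for i
      using that f' by (auto simp: f_def fs_families_def PiE_iff intro: inv_into_into f_inv_into_f)
    have "{i \<in> I. f i \<noteq> \<zero>} = {i \<in> I. f' i \<noteq> \<zero>\<^bsub>S\<^esub>}"
      using f h0 Ac by (metis (lifting))
    then have "f \<in> fs_families R I A" using f f' by (auto simp: fs_families_def f_def)
    moreover have "F f = f'" using f f' by (auto simp: F_def fs_families_def PiE_iff extensional_def)
    ultimately show "f' \<in> F ` fs_families R I A" by blast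
  qed
  have "additive_subgroup (h ` A i) S" if i: "i \<in> I" for i
  proof (rule additive_subgroup.intro)
    show "subgroup (h ` A i) (add_monoid S)"
      using A[OF i] a_group_hom group_hom.subgroup_img_is_subgroup
      unfolding additive_subgroup_def by blast
  qed
  moreover have "inj_on (fs_sum S I) (fs_families S I (\<lambda>i. h ` A i))"
    unfolding FI[symmetric]
  proof (rule inj_onI, elim imageE, hypsubst)
    fix f g assume fg: "f \<in> fs_families R I A" "g \<in> fs_families R I A"
      and "fs_sum S I (F f) = fs_sum S I (F g)"
    then have "h (fs_sum R I f) = h (fs_sum R I g)" by (simp add: sumF)
    moreover have "fs_sum R I f \<in> carrier R" "fs_sum R I g \<in> carrier R"
      using fg bij B by (auto simp: bij_betw_def)
    ultimately have "fs_sum R I f = fs_sum R I g" using inj by (auto dest: inj_onD)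
    then show "F f = F g" using fg bij by (auto simp: bij_betw_def dest: inj_onD)
  qed
  moreover have "fs_sum S I ` fs_families S I (\<lambda>i. h ` A i) = h ` B"
  proof -
    have "fs_sum S I ` F ` fs_families R I A = h ` fs_sum R I ` fs_families R I A"
      unfolding image_image by (intro image_cong refl sumF)
    then show ?thesis using bij by (simp add: FI bij_betw_def)
  qed
  ultimately show ?thesis by (simp add: is_direct_sum_def bij_betw_def)
qed

section \<open>Ideals generated by homogeneous elements\<close>

context cring begin

text \<open>Serves as an induction rule for elements of \<open>Idl E\<close>. The closure conditions
  make \<open>K\<close> an ideal: negatives are multiples by minus one, and commutativity supplies
  right multiples.\<close>

lemma ideal_subset_IdlI:
  assumes "E \<subseteq> carrier R"
    and "E \<subseteq> K" "K \<subseteq> carrier R" "\<zero> \<in> K" "\<And>x y. \<lbrakk>x \<in> K; y \<in> K\<rbrakk> \<Longrightarrow> x \<oplus> y \<in> K"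
      "\<And>r x. \<lbrakk>r \<in> carrier R; x \<in> K\<rbrakk> \<Longrightarrow> r \<otimes> x \<in> K"
  shows "Idl E \<subseteq> K"
proof (rule genideal_minimal)
  show "ideal K R"
  proof (rule idealI[OF ring_axioms])
    show "subgroup K (add_monoid R)"
    proof (unfold_locales, simp_all add: assms)
      fix x assume x: "x \<in> K"
      then have "\<ominus> x = (\<ominus> \<one>) \<otimes> x" using assms(3) l_minus[of \<one> x] by auto
      then show "inv\<^bsub>add_monoid R\<^esub> x \<in> K" using assms(6) x by (simp flip: a_inv_def)
    qed
    fix a x assume "a \<in> K" "x \<in> carrier R"
    then show "x \<otimes> a \<in> K" "a \<otimes> x \<in> K"
      using assms(6) m_comm[of a x] subsetD[OF assms(3)] by auto
  qed
qed (rule assms)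

lemma genideal_mono: "F \<subseteq> E \<Longrightarrow> Idl F \<subseteq> Idl E"
  unfolding genideal_def by blast

text \<open>The ideals generated by finite subsets of \<open>E\<close> are directed under inclusion,
  so their union is again an ideal, and it contains \<open>E\<close>.\<close>

lemma genideal_finitary:
  assumes E: "E \<subseteq> carrier R" and x: "x \<in> Idl E"
  obtains F where "finite F" "F \<subseteq> E" "x \<in> Idl F"
proof -
  let ?K = "\<Union>F\<in>{F. finite F \<and> F \<subseteq> E}. Idl F"
  have id: "ideal (Idl F) R" if "F \<subseteq> E" for F using that E by (blast intro: genideal_ideal)
  have "Idl E \<subseteq> ?K"
  proof (rule ideal_subset_IdlI[OF E])
    show "E \<subseteq> ?K"
    proof
      fix e assume "e \<in> E"
      then show "e \<in> ?K" using E genideal_self'[of e] by (intro UN_I[of "{e}"]) auto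
    qed
    show "?K \<subseteq> carrier R" by (auto dest!: id ideal.Icarr)
    show "\<zero> \<in> ?K" using additive_subgroup.zero_closed[OF ideal.axioms(1), OF id[of "{}"]] by blast
    fix x y assume "x \<in> ?K" "y \<in> ?K"
    then obtain F F' where F: "finite F" "F \<subseteq> E" "x \<in> Idl F" "finite F'" "F' \<subseteq> E" "y \<in> Idl F'"
      by auto
    then have "x \<in> Idl (F \<union> F')" "y \<in> Idl (F \<union> F')" using genideal_mono by blast+
    then have "x \<oplus> y \<in> Idl (F \<union> F')"
      using additive_subgroup.a_closed[OF ideal.axioms(1), OF id[of "F \<union> F'"]] F by simp
    then show "x \<oplus> y \<in> ?K" using F by blast
  next
    fix r x assume r: "r \<in> carrier R" and "x \<in> ?K"
    then obtain F where F: "finite F" "F \<subseteq> E" "x \<in> Idl F" by auto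
    then have "r \<otimes> x \<in> Idl F" using ideal.I_l_closed[OF id] r by blast
    then show "r \<otimes> x \<in> ?K" using F by blast
  qed
  then show thesis using x that by blast
qed

end

context graded_ring begin

lemma homogeneous_carrier: "homogeneous G \<R> \<subseteq> carrier R"
  using ring_decomp additive_subgroup.a_subset by (fastforce simp: homogeneous_def is_direct_sum_def)

lemma homogeneous_mult:
  "a \<in> homogeneous G \<R> \<Longrightarrow> b \<in> homogeneous G \<R> \<Longrightarrow> a \<otimes>\<^bsub>R\<^esub> b \<in> homogeneous G \<R>"
  unfolding homogeneous_def using ring_graded_mult G.m_closed by blast

lemma homogeneous_decomp:
  assumes "r \<in> carrier R"
  obtains T and c :: "'g \<Rightarrow> 'a" where "finite T" "c \<in> T \<rightarrow> homogeneous G \<R>" "r = (\<Oplus>\<^bsub>R\<^esub>g\<in>T. c g)"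
proof -
  obtain c where c: "c \<in> fs_families R (carrier G) \<R>" "fs_sum R (carrier G) c = r"
    using R.is_direct_sum_obtain[OF ring_decomp assms] .
  show thesis
    by (rule that[of "{g \<in> carrier G. c g \<noteq> \<zero>\<^bsub>R\<^esub>}" c])
      (use c in \<open>auto simp: fs_families_def fs_sum_def homogeneous_def\<close>)
qed

lemma graded_ideal_component:
  assumes "graded_ideal G R \<R> J" "c \<in> fs_families R (carrier G) \<R>"
    "fs_sum R (carrier G) c \<in> J" "g \<in> carrier G"
  shows "c g \<in> J"
  using R.is_direct_sum_component[OF ring_decomp] assms by (auto simp: graded_ideal_def)

text \<open>Every element of \<open>J\<close> is the finite sum of its components, which lie in
  \<open>J\<close> and hence in \<open>I\<close>. Closure under components is stated directly so
  that the lemma fits annihilators through \<open>ann_ring_component\<close>.\<close>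

lemma subset_ideal_of_homogeneous:
  assumes J: "J \<subseteq> carrier R" and I: "ideal I R" and sub: "J \<inter> homogeneous G \<R> \<subseteq> I"
    and comp: "\<And>c g. \<lbrakk>c \<in> fs_families R (carrier G) \<R>; fs_sum R (carrier G) c \<in> J; g \<in> carrier G\<rbrakk>
                 \<Longrightarrow> c g \<in> J"
  shows "J \<subseteq> I"
proof
  fix x assume x: "x \<in> J"
  obtain c where c: "c \<in> fs_families R (carrier G) \<R>" "fs_sum R (carrier G) c = x"
    using R.is_direct_sum_obtain[OF ring_decomp] x J by blast
  have "c g \<in> I" if "g \<in> carrier G" for g
    using sub comp[OF c(1) _ that] c x that by (auto simp: fs_families_def homogeneous_def)
  then show "x \<in> I"
    unfolding c(2)[symmetric] fs_sum_def
    by (intro R.additive_subgroup_finsum_closed[OF ideal.axioms(1)[OF I]]) auto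
qed

text \<open>The sums \<open>?K\<close> of homogeneous elements of the generated ideal form an ideal
  containing \<open>E\<close>, so they exhaust \<open>Idl E\<close>. This is the spanning condition
  of \<open>is_direct_sum_restrict_spanI\<close>.\<close>

lemma graded_ideal_Idl:
  assumes E: "E \<subseteq> homogeneous G \<R>"
  shows "graded_ideal G R \<R> (Idl\<^bsub>R\<^esub> E)"
proof -
  let ?J = "Idl\<^bsub>R\<^esub> E"
  let ?A = "\<lambda>g. ?J \<inter> \<R> g"
  let ?K = "fs_sum R (carrier G) ` fs_families R (carrier G) ?A"
  have Ec: "E \<subseteq> carrier R" using E homogeneous_carrier by blast
  have J: "ideal ?J R" by (rule R.genideal_ideal[OF Ec])
  have JK: "additive_subgroup ?J R" using J by (rule ideal.axioms(1))
  have A: "additive_subgroup (?A g) R" if "g \<in> carrier G" for g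
    using JK ring_decomp that R.a_group group.subgroups_Inter_pair
    unfolding additive_subgroup_def is_direct_sum_def by blast
  have single: "a \<in> ?K" if a: "a \<in> ?J" "a \<in> homogeneous G \<R>" for a
  proof -
    obtain g where "g \<in> carrier G" "a \<in> ?A g" using a by (auto simp: homogeneous_def)
    then show ?thesis using R.fs_sum_single[where A = ?A, OF A] by (metis (lifting) imageI)
  qed
  have KJ: "?K \<subseteq> ?J"
    unfolding fs_sum_def
    by (auto simp: fs_families_def intro!: R.additive_subgroup_finsum_closed[OF JK])
  have add: "x \<oplus>\<^bsub>R\<^esub> y \<in> ?K" if xy: "x \<in> ?K" "y \<in> ?K" for x y
  proof -
    obtain f g where "f \<in> fs_families R (carrier G) ?A" "x = fs_sum R (carrier G) f"
      "g \<in> fs_families R (carrier G) ?A" "y = fs_sum R (carrier G) g" using xy by blast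
    then show ?thesis
      using R.fs_sum_add[where A = ?A and I = "carrier G" and f = f and g = g, OF A]
      by (auto intro: rev_image_eqI)
  qed
  have zero: "\<zero>\<^bsub>R\<^esub> \<in> ?K"
  proof (rule single)
    show "\<zero>\<^bsub>R\<^esub> \<in> ?J" using additive_subgroup.zero_closed[OF JK] .
    show "\<zero>\<^bsub>R\<^esub> \<in> homogeneous G \<R>"
      using additive_subgroup.zero_closed ring_decomp G.one_closed
      unfolding homogeneous_def is_direct_sum_def by blast
  qed
  have Kc: "?K \<subseteq> carrier R" using KJ additive_subgroup.a_subset[OF JK] by blast
  have sum: "(\<Oplus>\<^bsub>R\<^esub>i\<in>T. c i) \<in> ?K" if "c \<in> T \<rightarrow> ?K" for c and T :: "'g set"
    using that
  proof (induction T rule: infinite_finite_induct)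
    case (insert i T)
    then have "c \<in> T \<rightarrow> carrier R" "c i \<in> carrier R" using Kc by blast+
    then show ?case using insert add by auto
  qed (use zero in auto)
  \<comment> \<open>Splitting both factors into homogeneous parts turns the product into a double
    sum of homogeneous elements of \<open>?J\<close>, each of which lies in \<open>?K\<close> by
    \<open>single\<close>.\<close>
  have smult: "r \<otimes>\<^bsub>R\<^esub> x \<in> ?K" if r: "r \<in> carrier R" and x: "x \<in> ?K" for r x
  proof -
    obtain f where f: "f \<in> fs_families R (carrier G) ?A" and xf: "x = fs_sum R (carrier G) f"
      using x by blast
    let ?T = "{g \<in> carrier G. f g \<noteq> \<zero>\<^bsub>R\<^esub>}"
    have fh: "f g \<in> ?J" "f g \<in> homogeneous G \<R>" if "g \<in> carrier G" for g
      using f that by (auto simp: fs_families_def homogeneous_def)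
    then have fc: "f \<in> ?T \<rightarrow> carrier R" using homogeneous_carrier by blast
    obtain U and c :: "'g \<Rightarrow> 'a" where U: "finite U" "c \<in> U \<rightarrow> homogeneous G \<R>" "r = (\<Oplus>\<^bsub>R\<^esub>g\<in>U. c g)"
      using homogeneous_decomp[OF r] .
    have cc: "c \<in> U \<rightarrow> carrier R" using U homogeneous_carrier by blast
    have "r \<otimes>\<^bsub>R\<^esub> f g \<in> ?K" if g: "g \<in> carrier G" for g
    proof -
      have "r \<otimes>\<^bsub>R\<^esub> f g = (\<Oplus>\<^bsub>R\<^esub>i\<in>U. c i \<otimes>\<^bsub>R\<^esub> f g)"
        using U cc fh(2)[OF g] homogeneous_carrier by (simp add: R.finsum_ldistr subset_iff)
      also have "\<dots> \<in> ?K"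
        using U fh[OF g] cc by (intro sum Pi_I single ideal.I_l_closed[OF J] homogeneous_mult) auto
      finally show ?thesis .
    qed
    then have "(\<Oplus>\<^bsub>R\<^esub>g\<in>?T. r \<otimes>\<^bsub>R\<^esub> f g) \<in> ?K" by (intro sum) auto
    then show ?thesis
      using f fc r unfolding xf fs_sum_def by (subst R.finsum_rdistr) (auto simp: fs_families_def)
  qed
  have "?J \<subseteq> ?K"
    using E R.genideal_self[OF Ec] single Kc zero add smult
    by (intro R.ideal_subset_IdlI[OF Ec]) blast+
  then show ?thesis
    using J R.is_direct_sum_restrict_spanI[OF ring_decomp JK] by (simp add: graded_ideal_def)
qed

text \<open>\<open>graded_secondful\<close> speaks of primes in the quotient by the annihilator of
  \<open>M\<close>, which is zero in the faithful case. The quotient map then sends \<open>r\<close>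
  to the singleton \<open>{r}\<close>; being an injective homomorphism, it carries the grading and
  primality along.\<close>

lemma graded_prime_ideal_quotient_zero:
  assumes p: "graded_prime_ideal G R \<R> p"
  shows "graded_prime_ideal G (R Quot {\<zero>\<^bsub>R\<^esub>}) (quotient_grading R \<R> {\<zero>\<^bsub>R\<^esub>}) (cosets_of R {\<zero>\<^bsub>R\<^esub>} p)"
proof -
  let ?Q = "R Quot {\<zero>\<^bsub>R\<^esub>}"
  let ?h = "(+>\<^bsub>R\<^esub>) {\<zero>\<^bsub>R\<^esub>}"
  have I: "ideal p R" and pD: "is_direct_sum R (carrier G) (\<lambda>g. p \<inter> \<R> g) p"
    and pne: "p \<noteq> carrier R"
    and prime: "\<And>a b. \<lbrakk>a \<in> homogeneous G \<R>; b \<in> homogeneous G \<R>; a \<otimes>\<^bsub>R\<^esub> b \<in> p\<rbrakk> \<Longrightarrow> a \<in> p \<or> b \<in> p"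
    using p by (auto simp: graded_prime_ideal_def graded_ideal_def)
  interpret h: ring_hom_ring R ?Q ?h
    by (rule ideal.rcos_ring_hom_ring[OF R.zeroideal])
  have h: "?h r = {r}" if "r \<in> carrier R" for r
    using that by (auto simp: a_r_coset_def')
  have inj: "inj_on ?h (carrier R)" by (auto intro!: inj_onI simp: h)
  have pc: "p \<subseteq> carrier R" by (auto dest: ideal.Icarr[OF I])
  have "is_direct_sum ?Q (carrier G) (\<lambda>g. ?h ` (p \<inter> \<R> g)) (?h ` p)"
    by (rule h.is_direct_sum_image[OF inj pD pc])
  \<comment> \<open>Injectivity lets the image commute with the intersection, giving the components
    the shape that \<open>graded_ideal\<close> demands.\<close>
  moreover have "?h ` (p \<inter> \<R> g) = ?h ` p \<inter> ?h ` \<R> g" if g: "g \<in> carrier G" for g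
    by (rule inj_on_image_Int[OF inj pc]) (use homogeneous_carrier g in \<open>auto simp: homogeneous_def\<close>)
  ultimately have "is_direct_sum ?Q (carrier G) (\<lambda>g. ?h ` p \<inter> ?h ` \<R> g) (?h ` p)"
    by (auto simp: is_direct_sum_def fs_families_def cong: PiE_cong)
  then have "graded_ideal G ?Q (quotient_grading R \<R> {\<zero>\<^bsub>R\<^esub>}) (?h ` p)"
    using R.ring_ideal_imp_quot_ideal[OF R.zeroideal I]
    by (simp add: graded_ideal_def quotient_grading_def cosets_of_def)
  moreover have "?h ` p \<noteq> carrier ?Q"
  proof
    have "carrier ?Q = ?h ` carrier R"
      unfolding FactRing_def A_RCOSETS_def' by (simp add: UNION_singleton_eq_range)
    moreover assume "?h ` p = carrier ?Q"
    ultimately show False using pne inj_on_image_eq_iff[OF inj pc order_refl] by (metis (lifting))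
  qed
  moreover have "homogeneous G (quotient_grading R \<R> {\<zero>\<^bsub>R\<^esub>}) = ?h ` homogeneous G \<R>"
    by (auto simp: homogeneous_def quotient_grading_def cosets_of_def)
  moreover have "?h a \<in> ?h ` p \<or> ?h b \<in> ?h ` p"
    if a: "a \<in> homogeneous G \<R>" and b: "b \<in> homogeneous G \<R>" and ab: "?h a \<otimes>\<^bsub>?Q\<^esub> ?h b \<in> ?h ` p" for a b
  proof -
    have c: "a \<in> carrier R" "b \<in> carrier R" using a b homogeneous_carrier by auto
    have "?h (a \<otimes>\<^bsub>R\<^esub> b) \<in> ?h ` p" unfolding h.hom_mult[OF c] by (rule ab)
    then have "a \<otimes>\<^bsub>R\<^esub> b \<in> p" using inj_on_image_mem_iff[OF inj R.m_closed[OF c] pc] by blast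
    then show ?thesis using prime[OF a b] by blast
  qed
  ultimately show ?thesis by (auto simp: graded_prime_ideal_def cosets_of_def)
qed

end

section \<open>Varieties and the Zariski socle\<close>

context graded_module begin

text \<open>The variety of a set of ring elements. Indexing varieties by subsets of the ring instead
  of submodules allows finite systems of equations; \<open>second_V\<close> is the case of an
  annihilator.\<close>

definition killed_by :: "'a set \<Rightarrow> 'b set set" where
  "killed_by J = {S \<in> second_Spec G R \<R> M \<M>. J \<subseteq> ann_ring R M S}"

lemma killed_by_antimono: "J \<subseteq> J' \<Longrightarrow> killed_by J' \<subseteq> killed_by J"
  by (auto simp: killed_by_def)

lemma killed_by_Un: "killed_by (J \<union> J') = killed_by J \<inter> killed_by J'"
  by (auto simp: killed_by_def)

lemma second_V_eq_killed_by: "second_V G R \<R> M \<M> N = killed_by (ann_ring R M N)"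
  by (simp add: second_V_def killed_by_def)

lemma ann_ring_ideal:
  assumes N: "N \<subseteq> carrier M"
  shows "ideal (ann_ring R M N) R"
proof (rule idealI[OF R.ring_axioms])
  have "r \<odot>\<^bsub>M\<^esub> x = \<zero>\<^bsub>M\<^esub> \<Longrightarrow> (\<ominus>\<^bsub>R\<^esub> r) \<odot>\<^bsub>M\<^esub> x = \<zero>\<^bsub>M\<^esub>" if "r \<in> carrier R" "x \<in> carrier M" for r x
    using that smult_l_minus[of r x] by simp
  then show "subgroup (ann_ring R M N) (add_monoid R)"
    using N by unfold_locales (auto simp: ann_ring_def smult_l_distr subset_iff simp flip: a_inv_def)
  fix a x assume a: "a \<in> ann_ring R M N" and x: "x \<in> carrier R"
  then show "x \<otimes>\<^bsub>R\<^esub> a \<in> ann_ring R M N"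
    using N by (auto simp: ann_ring_def smult_assoc1 subset_iff)
  then show "a \<otimes>\<^bsub>R\<^esub> x \<in> ann_ring R M N"
    using a x R.m_comm[of a x] by (simp add: ann_ring_def)
qed

lemma graded_second_ann_ideal: "S \<in> second_Spec G R \<R> M \<M> \<Longrightarrow> ideal (ann_ring R M S) R"
  by (intro ann_ring_ideal graded_secondD(1))

text \<open>If \<open>b\<close> does not kill \<open>S\<close>, then multiplication by
  \<open>b\<close> maps \<open>S\<close> onto itself, so an \<open>a\<close> that kills the image
  kills all of \<open>S\<close>.\<close>

lemma graded_second_ann_prime:
  assumes S: "S \<in> second_Spec G R \<R> M \<M>"
    and ab: "a \<in> homogeneous G \<R>" "b \<in> homogeneous G \<R>"
  shows "a \<otimes>\<^bsub>R\<^esub> b \<in> ann_ring R M S \<longleftrightarrow> a \<in> ann_ring R M S \<or> b \<in> ann_ring R M S"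
proof
  have c: "a \<in> carrier R" "b \<in> carrier R" using ab homogeneous_carrier by auto
  assume P: "a \<otimes>\<^bsub>R\<^esub> b \<in> ann_ring R M S"
  show "a \<in> ann_ring R M S \<or> b \<in> ann_ring R M S"
  proof (cases "(\<lambda>x. b \<odot>\<^bsub>M\<^esub> x) ` S = {\<zero>\<^bsub>M\<^esub>}")
    case True
    then show ?thesis using c by (auto simp: ann_ring_def)
  next
    case False
    then have b: "(\<lambda>x. b \<odot>\<^bsub>M\<^esub> x) ` S = S" using graded_secondD(4)[OF S ab(2)] by blast
    have "a \<odot>\<^bsub>M\<^esub> y = \<zero>\<^bsub>M\<^esub>" if y: "y \<in> S" for y
    proof -
      obtain x where x: "x \<in> S" "y = b \<odot>\<^bsub>M\<^esub> x" using b y by (metis (no_types, lifting) imageE)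
      then show ?thesis
        using P c graded_secondD(1)[OF S] smult_assoc1[of a b x] by (auto simp: ann_ring_def)
    qed
    then show ?thesis using c by (simp add: ann_ring_def)
  qed
next
  have c: "a \<in> carrier R" "b \<in> carrier R" using ab homogeneous_carrier by auto
  assume "a \<in> ann_ring R M S \<or> b \<in> ann_ring R M S"
  then show "a \<otimes>\<^bsub>R\<^esub> b \<in> ann_ring R M S"
    using c ideal.I_l_closed[OF graded_second_ann_ideal[OF S]]
      ideal.I_r_closed[OF graded_second_ann_ideal[OF S]] by blast
qed

lemma one_notin_graded_second_ann:
  assumes S: "S \<in> second_Spec G R \<R> M \<M>"
  shows "\<one>\<^bsub>R\<^esub> \<notin> ann_ring R M S"
proof
  assume "\<one>\<^bsub>R\<^esub> \<in> ann_ring R M S"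
  then have "\<one>\<^bsub>R\<^esub> \<odot>\<^bsub>M\<^esub> x = \<zero>\<^bsub>M\<^esub>" if "x \<in> S" for x
    using that by (simp add: ann_ring_def)
  then have "x = \<zero>\<^bsub>M\<^esub>" if "x \<in> S" for x
    using that smult_one[OF subsetD[OF graded_secondD(1)[OF S] that]] by metis
  then show False using graded_secondD(2,3)[OF S] by blast
qed

lemma killed_by_Idl:
  assumes "E \<subseteq> carrier R"
  shows "killed_by (Idl\<^bsub>R\<^esub> E) = killed_by E"
proof
  show "killed_by (Idl\<^bsub>R\<^esub> E) \<subseteq> killed_by E"
    by (rule killed_by_antimono[OF R.genideal_self[OF assms]])
  show "killed_by E \<subseteq> killed_by (Idl\<^bsub>R\<^esub> E)"
    using R.genideal_minimal[OF graded_second_ann_ideal] by (auto simp: killed_by_def)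
qed

text \<open>The annihilator of a graded submodule contains the components of its elements, so its
  homogeneous part imposes the same conditions. Closed sets thus become varieties of homogeneous
  sets.\<close>

lemma killed_by_ann_ring_homogeneous:
  assumes N: "graded_submodule G R M \<M> N"
  shows "killed_by (ann_ring R M N \<inter> homogeneous G \<R>) = killed_by (ann_ring R M N)"
proof -
  have "ann_ring R M N \<subseteq> ann_ring R M S"
    if S: "S \<in> second_Spec G R \<R> M \<M>" "ann_ring R M N \<inter> homogeneous G \<R> \<subseteq> ann_ring R M S" for S
  proof (rule subset_ideal_of_homogeneous[OF _ graded_second_ann_ideal[OF S(1)] S(2)])
    show "ann_ring R M N \<subseteq> carrier R" by (auto simp: ann_ring_def)
  qed (rule ann_ring_component[OF N])
  then show ?thesis by (auto simp: killed_by_def)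
qed

lemma second_V_ann_mod_Idl:
  assumes "E \<subseteq> carrier R"
  shows "second_V G R \<R> M \<M> (ann_mod M (Idl\<^bsub>R\<^esub> E)) = killed_by E"
proof -
  have "Idl\<^bsub>R\<^esub> E \<subseteq> carrier R" using ideal.Icarr[OF R.genideal_ideal[OF assms]] by (rule subsetI)
  from second_V_ann_mod[OF this] show ?thesis
    using killed_by_Idl[OF assms] by (simp add: killed_by_def)
qed

text \<open>The witness is the submodule annihilated by \<open>Idl E\<close>; it is graded because
  the ideal generated by homogeneous elements contains all components of its members.\<close>

lemma closedin_killed_by:
  assumes E: "E \<subseteq> homogeneous G \<R>"
  shows "closedin (second_Zariski G R \<R> M \<M>) (killed_by E)"
proof -
  have Ec: "E \<subseteq> carrier R" using E homogeneous_carrier by blast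
  have "graded_submodule G R M \<M> (ann_mod M (Idl\<^bsub>R\<^esub> E))"
    using ideal.Icarr[OF R.genideal_ideal[OF Ec]] graded_ideal_component[OF graded_ideal_Idl[OF E]]
    by (intro ann_mod_graded) auto
  then show ?thesis
    unfolding closedin_second_Zariski using second_V_ann_mod_Idl[OF Ec] by blast
qed

section \<open>Sums of families of submodules and the Zariski socle\<close>

lemma submodules_sum_upper:
  assumes S: "S \<in> \<S>" and c: "S \<subseteq> carrier M"
  shows "S \<subseteq> submodules_sum M \<S>"
proof
  fix y assume y: "y \<in> S"
  then have "y = (\<Oplus>\<^bsub>M\<^esub>S'\<in>{S}. y)" using c by auto
  then show "y \<in> submodules_sum M \<S>"
    unfolding submodules_sum_def using S y
    by (intro CollectI exI[of _ "{S}"] exI[of _ "\<lambda>_. y"]) auto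
qed

text \<open>The intersection with \<open>carrier R\<close> keeps the formula correct for the empty
  family, where the intersection of annihilators alone is \<open>UNIV\<close>.\<close>

lemma ann_ring_submodules_sum:
  assumes "\<And>S. S \<in> \<S> \<Longrightarrow> S \<subseteq> carrier M"
  shows "ann_ring R M (submodules_sum M \<S>) = carrier R \<inter> (\<Inter>S\<in>\<S>. ann_ring R M S)"
proof (intro equalityI subsetI)
  fix r assume "r \<in> ann_ring R M (submodules_sum M \<S>)"
  then show "r \<in> carrier R \<inter> (\<Inter>S\<in>\<S>. ann_ring R M S)"
    using submodules_sum_upper[OF _ assms] by (auto simp: ann_ring_def)
next
  fix r assume r: "r \<in> carrier R \<inter> (\<Inter>S\<in>\<S>. ann_ring R M S)"
  have "r \<odot>\<^bsub>M\<^esub> (\<Oplus>\<^bsub>M\<^esub>S\<in>F. x S) = \<zero>\<^bsub>M\<^esub>"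
    if F: "finite F" "F \<subseteq> \<S>" "x \<in> (\<Pi> S\<in>F. S)" for F x
  proof -
    have "x \<in> F \<rightarrow> carrier M" using F assms by blast
    then have "r \<odot>\<^bsub>M\<^esub> (\<Oplus>\<^bsub>M\<^esub>S\<in>F. x S) = (\<Oplus>\<^bsub>M\<^esub>S\<in>F. r \<odot>\<^bsub>M\<^esub> x S)"
      using F r by (intro finsum_smult_ldistr) auto
    also have "\<dots> = \<zero>\<^bsub>M\<^esub>"
      using F r by (intro M.add.finprod_one_eqI) (auto simp: ann_ring_def)
    finally show ?thesis .
  qed
  then show "r \<in> ann_ring R M (submodules_sum M \<S>)"
    using r by (auto simp: ann_ring_def submodules_sum_def)
qed

text \<open>Passing to the socle replaces the annihilator of \<open>N\<close> by the intersection of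
  all annihilators of graded second submodules above it. This larger ideal is contained in exactly
  the same such annihilators.\<close>

lemma second_V_Zariski_socle:
  "second_V G R \<R> M \<M> (Zariski_socle G R \<R> M \<M> N) = second_V G R \<R> M \<M> N"
proof -
  let ?V = "second_V G R \<R> M \<M> N"
  have "S \<subseteq> carrier M" if "S \<in> ?V" for S using that graded_secondD(1) by (auto simp: second_V_def)
  then have eq: "ann_ring R M (Zariski_socle G R \<R> M \<M> N) = carrier R \<inter> (\<Inter>S\<in>?V. ann_ring R M S)"
    unfolding Zariski_socle_def by (rule ann_ring_submodules_sum)
  have "ann_ring R M N \<subseteq> carrier R \<inter> (\<Inter>S\<in>?V. ann_ring R M S)"
    by (auto simp: second_V_def ann_ring_def)
  then show ?thesis
    unfolding second_V_eq_killed_by[of "Zariski_socle G R \<R> M \<M> N"] eq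
    by (auto simp: killed_by_def second_V_def)
qed

text \<open>The socle is defined from the variety alone, and the variety is recovered from the socle
  by \<open>second_V_Zariski_socle\<close>.\<close>

lemma Zariski_socle_eq_iff:
  "Zariski_socle G R \<R> M \<M> N = Zariski_socle G R \<R> M \<M> N' \<longleftrightarrow>
     second_V G R \<R> M \<M> N = second_V G R \<R> M \<M> N'"
  using second_V_Zariski_socle by (metis Zariski_socle_def)

lemma RFG_submodule_iff:
  "RFG_submodule G R \<R> M \<M> N \<longleftrightarrow> graded_submodule G R M \<M> N \<and>
     (\<exists>F. finite F \<and> F \<subseteq> homogeneous G \<R> \<and> killed_by (ann_ring R M N) = killed_by F)"
proof -
  have "(\<exists>I. graded_fg_ideal G R \<R> I \<and>
          Zariski_socle G R \<R> M \<M> N = Zariski_socle G R \<R> M \<M> (ann_mod M I)) \<longleftrightarrow>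
        (\<exists>F. finite F \<and> F \<subseteq> homogeneous G \<R> \<and> killed_by (ann_ring R M N) = killed_by F)"
  proof (intro iffI; elim exE conjE)
    fix I assume I: "graded_fg_ideal G R \<R> I"
      and Z: "Zariski_socle G R \<R> M \<M> N = Zariski_socle G R \<R> M \<M> (ann_mod M I)"
    obtain F where F: "F \<subseteq> homogeneous G \<R>" "finite F" "I = Idl\<^bsub>R\<^esub> F"
      using I by (auto simp: graded_fg_ideal_def)
    have "F \<subseteq> carrier R" using F homogeneous_carrier by blast
    then have "killed_by (ann_ring R M N) = killed_by F"
      using Z F(3) unfolding Zariski_socle_eq_iff by (simp add: second_V_ann_mod_Idl second_V_eq_killed_by[of N])
    then show "\<exists>F. finite F \<and> F \<subseteq> homogeneous G \<R> \<and> killed_by (ann_ring R M N) = killed_by F"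
      using F by blast
  next
    fix F assume F: "finite F" "F \<subseteq> homogeneous G \<R>" "killed_by (ann_ring R M N) = killed_by F"
    have Fc: "F \<subseteq> carrier R" using F homogeneous_carrier by blast
    have "graded_fg_ideal G R \<R> (Idl\<^bsub>R\<^esub> F)"
      unfolding graded_fg_ideal_def using F graded_ideal_Idl R.genideal_self[OF Fc] by blast
    moreover have "Zariski_socle G R \<R> M \<M> N = Zariski_socle G R \<R> M \<M> (ann_mod M (Idl\<^bsub>R\<^esub> F))"
      using F Fc unfolding Zariski_socle_eq_iff by (simp add: second_V_ann_mod_Idl second_V_eq_killed_by[of N])
    ultimately show "\<exists>I. graded_fg_ideal G R \<R> I \<and>
        Zariski_socle G R \<R> M \<M> N = Zariski_socle G R \<R> M \<M> (ann_mod M I)" by blast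
  qed
  then show ?thesis by (simp add: RFG_submodule_def)
qed

section \<open>Sums of two graded submodules\<close>

lemma ann_ring_set_add:
  assumes "submodule N1 R M" "submodule N2 R M"
  shows "ann_ring R M (N1 <+>\<^bsub>M\<^esub> N2) = ann_ring R M N1 \<inter> ann_ring R M N2"
proof -
  have c: "N1 \<subseteq> carrier M" "N2 \<subseteq> carrier M" using assms submoduleE(1) by auto
  have z: "\<zero>\<^bsub>M\<^esub> \<in> N1" "\<zero>\<^bsub>M\<^esub> \<in> N2"
    using assms subgroup.one_closed[of _ "add_monoid M"] by (auto simp: submodule_def)
  have sub: "x \<in> N1 <+>\<^bsub>M\<^esub> N2" if "x \<in> N1 \<or> x \<in> N2" for x
  proof (cases "x \<in> N1")
    case True
    then have "x = x \<oplus>\<^bsub>M\<^esub> \<zero>\<^bsub>M\<^esub>" using c by auto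
    then show ?thesis using True z unfolding set_add_def' by blast
  next
    case False
    then have "x \<in> N2" "x = \<zero>\<^bsub>M\<^esub> \<oplus>\<^bsub>M\<^esub> x" using c that by auto
    then show ?thesis using z unfolding set_add_def' by blast
  qed
  show ?thesis
  proof
    show "ann_ring R M (N1 <+>\<^bsub>M\<^esub> N2) \<subseteq> ann_ring R M N1 \<inter> ann_ring R M N2"
      using sub by (auto simp: ann_ring_def)
    show "ann_ring R M N1 \<inter> ann_ring R M N2 \<subseteq> ann_ring R M (N1 <+>\<^bsub>M\<^esub> N2)"
      using c by (auto simp: ann_ring_def set_add_def' smult_r_distr subset_iff)
  qed
qed

lemma submodule_set_add:
  assumes "submodule N1 R M" "submodule N2 R M"
  shows "submodule (N1 <+>\<^bsub>M\<^esub> N2) R M"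
proof -
  note N1 = submoduleE[OF assms(1)] and N2 = submoduleE[OF assms(2)]
  have "subgroup (N1 <+>\<^bsub>M\<^esub> N2) (add_monoid M)"
    using assms M.add_additive_subgroups
    by (auto simp: submodule_def additive_subgroup_def)
  moreover have "a \<odot>\<^bsub>M\<^esub> x \<in> N1 <+>\<^bsub>M\<^esub> N2" if ax: "a \<in> carrier R" "x \<in> N1 <+>\<^bsub>M\<^esub> N2" for a x
  proof -
    obtain x1 x2 where x: "x1 \<in> N1" "x2 \<in> N2" "x = x1 \<oplus>\<^bsub>M\<^esub> x2"
      using ax(2) by (auto simp: set_add_def')
    then have "a \<odot>\<^bsub>M\<^esub> x = a \<odot>\<^bsub>M\<^esub> x1 \<oplus>\<^bsub>M\<^esub> a \<odot>\<^bsub>M\<^esub> x2"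
      using ax(1) smult_r_distr subsetD[OF N1(1) x(1)] subsetD[OF N2(1) x(2)] by simp
    moreover have "a \<odot>\<^bsub>M\<^esub> x1 \<in> N1" "a \<odot>\<^bsub>M\<^esub> x2 \<in> N2"
      using N1(4)[OF ax(1) x(1)] N2(4)[OF ax(1) x(2)] .
    ultimately show ?thesis unfolding set_add_def' by blast
  qed
  ultimately show ?thesis by (simp add: submodule_def submodule_axioms_def)
qed

text \<open>Adding the decompositions of the two summands component by component yields one inside
  the sum; uniqueness comes from \<open>M\<close>.\<close>

lemma graded_submodule_set_add:
  assumes N1: "graded_submodule G R M \<M> N1" and N2: "graded_submodule G R M \<M> N2"
  shows "graded_submodule G R M \<M> (N1 <+>\<^bsub>M\<^esub> N2)"
proof -
  let ?N = "N1 <+>\<^bsub>M\<^esub> N2"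
  have s: "submodule N1 R M" "submodule N2 R M" using N1 N2 by (auto simp: graded_submodule_def)
  have N: "submodule ?N R M" by (rule submodule_set_add[OF s])
  then have Na: "additive_subgroup ?N M" by (simp add: submodule_def additive_subgroup_def)
  have A: "additive_subgroup (\<M> g) M" if "g \<in> carrier G" for g
    using module_decomp that by (simp add: is_direct_sum_def)
  have "is_direct_sum M (carrier G) (\<lambda>g. ?N \<inter> \<M> g) ?N"
  proof (rule M.is_direct_sum_restrict_spanI[OF module_decomp Na], rule subsetI)
    fix x assume "x \<in> ?N"
    then obtain x1 x2 where x: "x1 \<in> N1" "x2 \<in> N2" "x = x1 \<oplus>\<^bsub>M\<^esub> x2"
      by (auto simp: set_add_def')
    obtain f1 where f1: "f1 \<in> fs_families M (carrier G) (\<lambda>g. N1 \<inter> \<M> g)" "fs_sum M (carrier G) f1 = x1"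
      using N1 x(1) M.is_direct_sum_obtain unfolding graded_submodule_def by metis
    obtain f2 where f2: "f2 \<in> fs_families M (carrier G) (\<lambda>g. N2 \<inter> \<M> g)" "fs_sum M (carrier G) f2 = x2"
      using N2 x(2) M.is_direct_sum_obtain unfolding graded_submodule_def by metis
    let ?f = "\<lambda>g\<in>carrier G. f1 g \<oplus>\<^bsub>M\<^esub> f2 g"
    have "f1 \<in> fs_families M (carrier G) \<M>" "f2 \<in> fs_families M (carrier G) \<M>"
      using f1 f2 by (auto simp: fs_families_def)
    note f = M.fs_sum_add[where A = \<M>, OF A this]
    have "?f g \<in> ?N" if "g \<in> carrier G" for g
      using f1 f2 that by (auto simp: fs_families_def set_add_def' PiE_iff)
    then have "?f \<in> fs_families M (carrier G) (\<lambda>g. ?N \<inter> \<M> g)"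
      using f(1) by (auto simp: fs_families_def)
    then show "x \<in> fs_sum M (carrier G) ` fs_families M (carrier G) (\<lambda>g. ?N \<inter> \<M> g)"
      using f(2) f1(2) f2(2) x(3) by (auto intro: rev_image_eqI)
  qed
  then show ?thesis using N by (simp add: graded_submodule_def)
qed

text \<open>If all products kill \<open>S\<close> but some \<open>a\<close> in \<open>A\<close> does
  not, primeness of the annihilator on homogeneous elements forces every \<open>b\<close> in
  \<open>B\<close> to kill \<open>S\<close>.\<close>

lemma killed_by_products:
  assumes "A \<subseteq> homogeneous G \<R>" "B \<subseteq> homogeneous G \<R>"
  shows "killed_by (\<Union>a\<in>A. \<Union>b\<in>B. {a \<otimes>\<^bsub>R\<^esub> b}) = killed_by A \<union> killed_by B"
  using assms graded_second_ann_prime by (auto simp: killed_by_def subset_iff) blast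

lemma RFG_submodule_set_add:
  assumes N1: "RFG_submodule G R \<R> M \<M> N1" and N2: "RFG_submodule G R \<R> M \<M> N2"
  shows "RFG_submodule G R \<R> M \<M> (N1 <+>\<^bsub>M\<^esub> N2)"
proof -
  obtain A B where A: "finite A" "A \<subseteq> homogeneous G \<R>" "killed_by (ann_ring R M N1) = killed_by A"
    and B: "finite B" "B \<subseteq> homogeneous G \<R>" "killed_by (ann_ring R M N2) = killed_by B"
    and g: "graded_submodule G R M \<M> N1" "graded_submodule G R M \<M> N2"
    using N1 N2 unfolding RFG_submodule_iff by blast
  let ?F = "\<Union>a\<in>A. \<Union>b\<in>B. {a \<otimes>\<^bsub>R\<^esub> b}"
  have "killed_by (ann_ring R M (N1 <+>\<^bsub>M\<^esub> N2)) = killed_by (ann_ring R M N1 \<inter> ann_ring R M N2)"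
    using g by (simp add: ann_ring_set_add graded_submodule_def)
  also have "\<dots> = killed_by (ann_ring R M N1) \<union> killed_by (ann_ring R M N2)"
    using second_V_Un[OF g] by (simp add: second_V_eq_killed_by killed_by_def)
  also have "\<dots> = killed_by ?F"
    using killed_by_products[OF A(2) B(2)] A(3) B(3) by simp
  finally have "killed_by (ann_ring R M (N1 <+>\<^bsub>M\<^esub> N2)) = killed_by ?F" .
  moreover have "finite ?F" "?F \<subseteq> homogeneous G \<R>"
    using A(1) B(1) subsetD[OF A(2)] subsetD[OF B(2)] by (auto intro: homogeneous_mult)
  ultimately show ?thesis
    unfolding RFG_submodule_iff using graded_submodule_set_add[OF g] by blast
qed

section \<open>Noetherian spectra\<close>

text \<open>An analogue of finite generation up to radical. The finite set is taken inside
  \<open>E\<close>, so that in a chain it already lies in a single member.\<close>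

definition finitely_cut :: "'a set \<Rightarrow> bool" where
  "finitely_cut E \<longleftrightarrow> (\<exists>F\<subseteq>E. finite F \<and> killed_by F = killed_by E)"

lemma finitely_cutI: "F \<subseteq> E \<Longrightarrow> finite F \<Longrightarrow> killed_by F \<subseteq> killed_by E \<Longrightarrow> finitely_cut E"
  unfolding finitely_cut_def using killed_by_antimono by blast

text \<open>Otherwise every finite subset of \<open>E\<close> can be enlarged by one element of
  \<open>E\<close> so that the variety shrinks strictly; iteration contradicts the descending chain
  condition.\<close>

lemma noetherian_imp_finitely_cut:
  assumes T: "noetherian_space (second_Zariski G R \<R> M \<M>)" and E: "E \<subseteq> homogeneous G \<R>"
  shows "finitely_cut E"
proof (rule ccontr)
  assume n: "\<not> finitely_cut E"
  have "\<exists>x\<in>E. killed_by (insert x F) \<noteq> killed_by F" if F: "finite F" "F \<subseteq> E" for F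
  proof (rule ccontr)
    assume "\<not> ?thesis"
    then have "killed_by F \<subseteq> killed_by {x}" if "x \<in> E" for x
      using that killed_by_Un[of "{x}" F] by auto
    then have "killed_by F \<subseteq> killed_by E" using F by (fastforce simp: killed_by_def)
    then show False using n F finitely_cutI by blast
  qed
  then obtain p where p: "\<And>F. finite F \<Longrightarrow> F \<subseteq> E \<Longrightarrow> p F \<in> E \<and> killed_by (insert (p F) F) \<noteq> killed_by F"
    by metis
  \<comment> \<open>Starting from the empty set, each stage adds the element that \<open>p\<close>
    selects to shrink the current variety.\<close>
  define F where "F = rec_nat {} (\<lambda>_ F. insert (p F) F)"
  have F_simps: "F 0 = {}" "F (Suc n) = insert (p (F n)) (F n)" for n by (simp_all add: F_def)
  have F: "finite (F n) \<and> F n \<subseteq> E" for n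
    by (induction n) (use p in \<open>auto simp: F_simps\<close>)
  have "closedin (second_Zariski G R \<R> M \<M>) (killed_by (F n))" for n
    using F E by (intro closedin_killed_by) blast
  moreover have "decseq (\<lambda>n. killed_by (F n))"
    by (intro decseq_SucI killed_by_antimono) (auto simp: F_simps)
  ultimately obtain m where m: "\<And>n. n \<ge> m \<Longrightarrow> killed_by (F n) = killed_by (F m)"
    using T unfolding noetherian_space_def by meson
  have "killed_by (F (Suc m)) = killed_by (F m)" by (rule m) simp
  then show False using p[of "F m"] F by (simp add: F_simps)
qed

text \<open>The intersection of the whole chain is the variety of a finite set, whose elements come
  from finitely many stages. The chain is constant from the last of these stages on.\<close>

lemma noetherian_if_finitely_cut:
  assumes cut: "\<And>E. E \<subseteq> homogeneous G \<R> \<Longrightarrow> finitely_cut E"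
  shows "noetherian_space (second_Zariski G R \<R> M \<M>)"
  unfolding noetherian_space_def
proof (intro allI impI, elim conjE)
  fix C assume cl: "\<forall>n. closedin (second_Zariski G R \<R> M \<M>) (C n)" and dec: "decseq C"
  have "\<exists>E \<subseteq> homogeneous G \<R>. C n = killed_by E" for n
    using cl killed_by_ann_ring_homogeneous
    unfolding closedin_second_Zariski second_V_eq_killed_by by (metis inf_le2)
  then obtain e where e: "\<And>n. e n \<subseteq> homogeneous G \<R>" "\<And>n. C n = killed_by (e n)" by metis
  have "finitely_cut (\<Union>n. e n)" using e(1) by (intro cut) blast
  then obtain F where F: "F \<subseteq> (\<Union>n. e n)" "finite F" "killed_by F = killed_by (\<Union>n. e n)"
    unfolding finitely_cut_def by blast
  obtain k where k: "\<And>x. x \<in> F \<Longrightarrow> x \<in> e (k x)" using F(1) by (metis UN_E subsetD)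
  define N where "N = k ` F"
  have N: "finite N" "F \<subseteq> (\<Union>n\<in>N. e n)" using F(2) k by (auto simp: N_def)
  \<comment> \<open>Inserting 0 keeps \<open>Max\<close> meaningful when \<open>F\<close>, and with
    it \<open>N\<close>, is empty.\<close>
  define m where "m = Max (insert 0 N)"
  have "C m \<subseteq> C n" for n
  proof -
    \<comment> \<open>The sets \<open>e n\<close> need not increase, only their varieties decrease;
      hence \<open>F\<close> is treated stage by stage instead of being placed inside
      \<open>e m\<close>.\<close>
    have Cm: "C m \<subseteq> killed_by (e n)" if "n \<in> N" for n
      using decseqD[OF dec, of n m] N(1) that by (simp add: m_def e(2))
    have "C m \<subseteq> killed_by F"
    proof
      fix S assume S: "S \<in> C m"
      have "F \<subseteq> ann_ring R M S"
        using N(2) subsetD[OF Cm S] by (auto simp: killed_by_def subset_iff)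
      then show "S \<in> killed_by F" using S by (simp add: e(2) killed_by_def)
    qed
    also have "\<dots> \<subseteq> C n" unfolding F(3) e(2) by (rule killed_by_antimono) blast
    finally show ?thesis .
  qed
  then show "\<exists>m. \<forall>n\<ge>m. C n = C m" using decseqD[OF dec] by blast
qed

section \<open>Graded primes as annihilators of graded second submodules\<close>

lemma ann_ring_faithful:
  assumes "graded_faithful G R \<R> M"
  shows "ann_ring R M (carrier M) = {\<zero>\<^bsub>R\<^esub>}"
proof
  have "submodule (carrier M) R M" by (rule carrier_is_submodule)
  moreover have "is_direct_sum M (carrier G) (\<lambda>g. carrier M \<inter> \<M> g) (carrier M)"
    using module_homogeneous_carrier
    by (intro M.is_direct_sum_restrictI[OF module_decomp])
      (use calculation in \<open>auto simp: submodule_def additive_subgroup_def dest: module_component\<close>)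
  ultimately have g: "graded_submodule G R M \<M> (carrier M)" by (simp add: graded_submodule_def)
  \<comment> \<open>Faithfulness only tests homogeneous elements; it extends to the whole
    annihilator because \<open>carrier M\<close> is graded, so components of annihilating elements
    annihilate too.\<close>
  show "ann_ring R M (carrier M) \<subseteq> {\<zero>\<^bsub>R\<^esub>}"
  proof (rule subset_ideal_of_homogeneous[OF _ R.zeroideal])
    show "ann_ring R M (carrier M) \<inter> homogeneous G \<R> \<subseteq> {\<zero>\<^bsub>R\<^esub>}"
      using assms by (auto simp: ann_ring_def graded_faithful_def)
    show "ann_ring R M (carrier M) \<subseteq> carrier R" by (auto simp: ann_ring_def)
  qed (rule ann_ring_component[OF g])
qed (auto simp: ann_ring_def)

text \<open>Surjectivity of the natural map gives \<open>S\<close> with the right image in the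
  quotient by zero. Cosets there are singletons, so equality of images is equality of
  ideals.\<close>

lemma graded_prime_eq_ann:
  assumes sf: "graded_secondful G R \<R> M \<M>" and f: "graded_faithful G R \<R> M"
    and p: "graded_prime_ideal G R \<R> p"
  obtains S where "S \<in> second_Spec G R \<R> M \<M>" "ann_ring R M S = p"
proof -
  have "cosets_of R {\<zero>\<^bsub>R\<^esub>} p \<in> graded_Spec G (R Quot {\<zero>\<^bsub>R\<^esub>}) (quotient_grading R \<R> {\<zero>\<^bsub>R\<^esub>})"
    using graded_prime_ideal_quotient_zero[OF p] by (simp add: graded_Spec_def)
  then obtain S where S: "S \<in> second_Spec G R \<R> M \<M>"
    "cosets_of R {\<zero>\<^bsub>R\<^esub>} p = cosets_of R {\<zero>\<^bsub>R\<^esub>} (ann_ring R M S)"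
    using sf unfolding graded_secondful_def Let_def ann_ring_faithful[OF f] by blast
  have "cosets_of R {\<zero>\<^bsub>R\<^esub>} J = (\<lambda>r. {r}) ` J" if "J \<subseteq> carrier R" for J
    unfolding cosets_of_def using that by (intro image_cong) (auto simp: a_r_coset_def')
  moreover have "p \<subseteq> carrier R"
    using p ideal.Icarr[of p R] by (simp add: graded_prime_ideal_def graded_ideal_def subset_iff)
  moreover have "ann_ring R M S \<subseteq> carrier R" by (auto simp: ann_ring_def)
  ultimately have "(\<lambda>r. {r}) ` p = (\<lambda>r. {r}) ` ann_ring R M S" using S(2) by simp
  then have "p = ann_ring R M S" by (simp add: inj_image_eq_iff)
  then show thesis using S(1) that by blast
qed

section \<open>Reduction to graded primes in the manner of Cohen\<close>

lemma finitely_cut_Idl_obtain: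
  assumes E: "E \<subseteq> carrier R" and B: "finite B" "B \<subseteq> Idl\<^bsub>R\<^esub> E"
  obtains F where "finite F" "F \<subseteq> E" "killed_by F \<subseteq> killed_by B"
proof -
  have "\<exists>F. finite F \<and> F \<subseteq> E \<and> killed_by F \<subseteq> killed_by B"
    using B
  proof (induction B)
    case (insert b B)
    then obtain F where F: "finite F" "F \<subseteq> E" "killed_by F \<subseteq> killed_by B" by blast
    \<comment> \<open>Membership of \<open>b\<close> in the ideal involves only finitely many
      generators, and whatever they kill is killed by \<open>b\<close> as well.\<close>
    obtain F' where F': "finite F'" "F' \<subseteq> E" "b \<in> Idl\<^bsub>R\<^esub> F'"
      using R.genideal_finitary[OF E] insert.prems by blast
    have "killed_by F' \<subseteq> killed_by {b}"
      using killed_by_Idl[of F'] killed_by_antimono[of "{b}" "Idl\<^bsub>R\<^esub> F'"] F' E by auto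
    then have "killed_by (F \<union> F') \<subseteq> killed_by (insert b B)"
      using F killed_by_Un[of "{b}" B] by (auto simp: killed_by_Un)
    then show ?case using F F' by (intro exI[of _ "F \<union> F'"]) auto
  qed (auto simp: killed_by_def)
  then show thesis using that by blast
qed

text \<open>Zorn's lemma gives a maximal homogeneous set \<open>X\<close> that is not finitely cut.
  Its ideal is shown to be graded prime; since that ideal has the same variety as \<open>X\<close>,
  the hypothesis on primes contradicts the choice of \<open>X\<close>.\<close>

lemma finitely_cut_if_primes:
  assumes primes: "\<And>p. graded_prime_ideal G R \<R> p \<Longrightarrow> finitely_cut p"
    and E: "E \<subseteq> homogeneous G \<R>"
  shows "finitely_cut E"
proof (rule ccontr)
  assume nE: "\<not> finitely_cut E"
  define \<B> where "\<B> = {E. E \<subseteq> homogeneous G \<R> \<and> \<not> finitely_cut E}"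
  have "\<exists>X\<in>\<B>. \<forall>Y\<in>\<B>. X \<subseteq> Y \<longrightarrow> Y = X"
  proof (rule subset_Zorn_nonempty)
    show "\<B> \<noteq> {}" using E nE by (auto simp: \<B>_def)
    fix \<C> assume ne: "\<C> \<noteq> {}" and ch: "subset.chain \<B> \<C>"
    \<comment> \<open>A finite subset of the union lies in one member of the chain and would already
      cut out the variety of that member.\<close>
    have "\<not> finitely_cut (\<Union>\<C>)"
    proof
      assume "finitely_cut (\<Union>\<C>)"
      then obtain F where F: "F \<subseteq> \<Union>\<C>" "finite F" "killed_by F = killed_by (\<Union>\<C>)"
        by (auto simp: finitely_cut_def)
      obtain X where X: "X \<in> \<C>" "F \<subseteq> X" using finite_subset_Union_chain[OF F(2,1) ne ch] .
      have "killed_by F \<subseteq> killed_by X" unfolding F(3) using X by (intro killed_by_antimono) blast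
      then have "finitely_cut X" using finitely_cutI X F by blast
      then show False using ch X by (auto simp: \<B>_def subset.chain_def)
    qed
    then show "\<Union>\<C> \<in> \<B>" using ch by (auto simp: \<B>_def subset.chain_def)
  qed
  then obtain X where X: "X \<subseteq> homogeneous G \<R>" "\<not> finitely_cut X"
    and max: "\<And>Y. \<lbrakk>Y \<subseteq> homogeneous G \<R>; X \<subseteq> Y; Y \<noteq> X\<rbrakk> \<Longrightarrow> finitely_cut Y"
    unfolding \<B>_def by (smt (verit) mem_Collect_eq)
  have Xc: "X \<subseteq> carrier R" using X homogeneous_carrier by blast
  let ?p = "Idl\<^bsub>R\<^esub> X"
  \<comment> \<open>Finite subsets of the generated ideal fail as well, since they can be traded for
    finite sets of generators from \<open>X\<close>. This makes the element
    \<open>a \<otimes> b\<close> of \<open>?p\<close> usable below.\<close>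
  have not_fin: "\<not> killed_by B \<subseteq> killed_by X" if "finite B" "B \<subseteq> ?p" for B
    using finitely_cut_Idl_obtain[OF Xc that] finitely_cutI X(2) by (metis subset_trans)
  have "graded_prime_ideal G R \<R> ?p"
    unfolding graded_prime_ideal_def
  proof (intro conjI ballI impI)
    show "graded_ideal G R \<R> ?p" by (rule graded_ideal_Idl[OF X(1)])
    \<comment> \<open>If the ideal were everything, the unit alone would be a finite subset with
      empty variety, contrary to \<open>not_fin\<close>.\<close>
    have "killed_by {\<one>\<^bsub>R\<^esub>} = {}" using one_notin_graded_second_ann by (auto simp: killed_by_def)
    then show "?p \<noteq> carrier R" using not_fin[of "{\<one>\<^bsub>R\<^esub>}"] by auto
    fix a b assume a: "a \<in> homogeneous G \<R>" and b: "b \<in> homogeneous G \<R>" and ab: "a \<otimes>\<^bsub>R\<^esub> b \<in> ?p"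
    show "a \<in> ?p \<or> b \<in> ?p"
    proof (rule ccontr)
      assume n: "\<not> (a \<in> ?p \<or> b \<in> ?p)"
      \<comment> \<open>By maximality \<open>insert y X\<close> is finitely cut. The finite set may
        use \<open>y\<close> itself, so \<open>y\<close> is removed and its condition is kept as the
        factor \<open>killed_by {y}\<close>.\<close>
      have *: "\<exists>F. finite F \<and> F \<subseteq> X \<and> killed_by F \<inter> killed_by {y} \<subseteq> killed_by X"
        if y: "y \<in> homogeneous G \<R>" "y \<notin> ?p" for y
      proof -
        have "y \<notin> X" using y R.genideal_self[OF Xc] by blast
        then have "finitely_cut (insert y X)" using max[of "insert y X"] y X by blast
        then obtain F where F: "F \<subseteq> insert y X" "finite F" "killed_by F = killed_by (insert y X)"
          by (auto simp: finitely_cut_def)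
        have "killed_by (F - {y}) \<inter> killed_by {y} \<subseteq> killed_by F"
          unfolding killed_by_Un[symmetric] by (rule killed_by_antimono) blast
        also have "\<dots> \<subseteq> killed_by X" unfolding F(3) by (rule killed_by_antimono) blast
        finally show ?thesis using F by (intro exI[of _ "F - {y}"]) auto
      qed
      obtain F1 F2 where F: "finite F1" "F1 \<subseteq> X" "killed_by F1 \<inter> killed_by {a} \<subseteq> killed_by X"
        "finite F2" "F2 \<subseteq> X" "killed_by F2 \<inter> killed_by {b} \<subseteq> killed_by X"
        using *[OF a] *[OF b] n by blast
      have "killed_by {a \<otimes>\<^bsub>R\<^esub> b} = killed_by {a} \<union> killed_by {b}"
        using killed_by_products[of "{a}" "{b}"] a b by simp
      then have "killed_by (F1 \<union> F2 \<union> {a \<otimes>\<^bsub>R\<^esub> b}) \<subseteq> killed_by X"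
        using F unfolding killed_by_Un by blast
      then show False
        using not_fin[of "F1 \<union> F2 \<union> {a \<otimes>\<^bsub>R\<^esub> b}"] F ab R.genideal_self[OF Xc] by blast
    qed
  qed
  then obtain B where "B \<subseteq> ?p" "finite B" "killed_by B = killed_by ?p"
    using primes unfolding finitely_cut_def by blast
  then show False using not_fin[of B] killed_by_Idl[OF Xc] by simp
qed

lemma noetherian_iff_graded_second_RFG:
  assumes sf: "graded_secondful G R \<R> M \<M>" and f: "graded_faithful G R \<R> M"
  shows "noetherian_space (second_Zariski G R \<R> M \<M>) \<longleftrightarrow>
    (\<forall>S. graded_second G R \<R> M \<M> S \<longrightarrow> RFG_submodule G R \<R> M \<M> S)"
proof (intro iffI allI impI)
  fix S assume T: "noetherian_space (second_Zariski G R \<R> M \<M>)" and S: "graded_second G R \<R> M \<M> S"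
  have g: "graded_submodule G R M \<M> S" using S by (simp add: graded_second_def)
  obtain F where "F \<subseteq> ann_ring R M S \<inter> homogeneous G \<R>" "finite F"
    "killed_by F = killed_by (ann_ring R M S)"
    using noetherian_imp_finitely_cut[OF T, of "ann_ring R M S \<inter> homogeneous G \<R>"]
    unfolding finitely_cut_def killed_by_ann_ring_homogeneous[OF g] by blast
  then show "RFG_submodule G R \<R> M \<M> S" unfolding RFG_submodule_iff using g by blast
next
  assume RFG: "\<forall>S. graded_second G R \<R> M \<M> S \<longrightarrow> RFG_submodule G R \<R> M \<M> S"
  show "noetherian_space (second_Zariski G R \<R> M \<M>)"
  proof (rule noetherian_if_finitely_cut, rule finitely_cut_if_primes)
    fix p assume "graded_prime_ideal G R \<R> p"
    then obtain S where S: "S \<in> second_Spec G R \<R> M \<M>" "ann_ring R M S = p"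
      using graded_prime_eq_ann[OF sf f] by blast
    then obtain F where F: "finite F" "killed_by p = killed_by F"
      using RFG unfolding RFG_submodule_iff second_Spec_def by blast
    \<comment> \<open>The finite set supplied by the \<open>RFG_submodule\<close> property need not
      lie in \<open>p\<close> a priori. Since \<open>S\<close> belongs to the variety of its own
      annihilator \<open>p\<close>, it is killed by \<open>F\<close>, which places \<open>F\<close>
      inside \<open>p\<close>.\<close>
    have "S \<in> killed_by F" using S F(2) by (auto simp: killed_by_def)
    then have "F \<subseteq> p" using S(2) by (auto simp: killed_by_def)
    then show "finitely_cut p" using F by (auto simp: finitely_cut_def)
  qed
qed

end

theorem corollary4p12:
  fixes G :: "('g, 'k) monoid_scheme" and R :: "('a, 'm) ring_scheme" and \<R> :: "'g \<Rightarrow> 'a set"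
    and M :: "('a, 'b, 'n) module_scheme" and \<M> :: "'g \<Rightarrow> 'b set"
  assumes "graded_module G R \<R> M \<M>"
    and "graded_secondful G R \<R> M \<M>"
    and "graded_faithful G R \<R> M"
  shows "(noetherian_space (second_Zariski G R \<R> M \<M>) \<longleftrightarrow>
            (\<forall>S. graded_second G R \<R> M \<M> S \<longrightarrow> RFG_submodule G R \<R> M \<M> S)) \<and>
         (\<forall>N1 N2. RFG_submodule G R \<R> M \<M> N1 \<and> RFG_submodule G R \<R> M \<M> N2 \<longrightarrow>
            RFG_submodule G R \<R> M \<M> (N1 <+>\<^bsub>M\<^esub> N2))"
proof -
  interpret graded_module G R \<R> M \<M> by (rule assms(1))
  show ?thesis using noetherian_iff_graded_second_RFG assms(2,3) RFG_submodule_set_add by blast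
qed

end
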